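(* Let $p$ be a positive integer and suppose $G$ is a simple graph of order $p+3$ not containing $B_p$ as a subgraph. (1) If $p=2$, then $G$ has size $\mathrm{ex}(p+3,B_p)$ if and only if $G=K_1\vee (2P_2)$, or $G=K_{2,3}$, or $G=\overline{P_5}$; if $p$ is even and $p\ge 4$, then $G$ has size $\mathrm{ex}(p+3,B_p)$ if and only if $G=(3K_1)\vee (K_p-PM)$ or $G=\overline{P_5}\vee (K_{p-2}-PM)$. (2) If $p$ is odd, then $G$ has size $\mathrm{ex}(p+3,B_p)$ if and only if $G=K_{p+3}-PM$.
   Context: Graphs are finite and simple; equality of graphs means isomorphism. The book $B_p$ is the graph consisting of $p$ triangles sharing a common edge. For a graph $H$ and positive integer $n$, $\mathrm{ex}(n,H)$ is the maximum number of edges of a simple graph of order $n$ not containing $H$ as a subgraph. $mH$ denotes the disjoint union of $m$ copies of $H$, $G\vee H$ the join (disjoint union plus all edges between $G$ and $H$), $\overline{G}$ the complement. $K_n$ is the complete graph, $K_{s,t}$ the complete bipartite graph, $P_t$ the path on $t$ vertices. For even $n$, $K_n-PM$ is the graph obtained from $K_n$ by deleting the edges of a perfect matching, i.e. the complement of $(n/2)K_2$. *)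

theory Defs imports Main begin

record 'a sgraph =
  verts :: "'a set"
  edges :: "'a set set"

definition simple_graph :: "'a sgraph \<Rightarrow> bool" where
  "simple_graph G \<longleftrightarrow> finite (verts G) \<and> (\<forall>e\<in>edges G. e \<subseteq> verts G \<and> card e = 2)"

definition graph_order :: "'a sgraph \<Rightarrow> nat" where
  "graph_order G = card (verts G)"

definition graph_size :: "'a sgraph \<Rightarrow> nat" where
  "graph_size G = card (edges G)"

definition graph_iso :: "'a sgraph \<Rightarrow> 'b sgraph \<Rightarrow> bool" (infix "\<simeq>" 50) where
  "G \<simeq> H \<longleftrightarrow> (\<exists>f. bij_betw f (verts G) (verts H) \<and>
     (\<forall>u\<in>verts G. \<forall>v\<in>verts G. {u, v} \<in> edges G \<longleftrightarrow> {f u, f v} \<in> edges H))"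

definition subgraph_of :: "'a sgraph \<Rightarrow> 'a sgraph \<Rightarrow> bool" where
  "subgraph_of K G \<longleftrightarrow> simple_graph K \<and> verts K \<subseteq> verts G \<and> edges K \<subseteq> edges G"

definition contains_copy :: "'a sgraph \<Rightarrow> 'b sgraph \<Rightarrow> bool" where
  "contains_copy G H \<longleftrightarrow> (\<exists>K. subgraph_of K G \<and> K \<simeq> H)"

text \<open>Every finite graph has an isomorphic copy with natural numbers as vertices, so it
  suffices to let the host graphs range over those. The set is nonempty iff \<open>H\<close> is not
  contained in the edgeless graph on \<open>n\<close> vertices, e.g. if \<open>H\<close> has an edge.\<close>
definition ex_number :: "nat \<Rightarrow> 'b sgraph \<Rightarrow> nat" where
  "ex_number n H = Max {graph_size G | G :: nat sgraph.
     simple_graph G \<and> graph_order G = n \<and> \<not> contains_copy G H}"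

definition all_pairs :: "'a set \<Rightarrow> 'a set set" where
  "all_pairs V = {{u, v} | u v. u \<in> V \<and> v \<in> V \<and> u \<noteq> v}"

definition complement :: "'a sgraph \<Rightarrow> 'a sgraph" where
  "complement G = \<lparr>verts = verts G, edges = all_pairs (verts G) - edges G\<rparr>"

definition join :: "'a sgraph \<Rightarrow> 'b sgraph \<Rightarrow> ('a + 'b) sgraph" where
  "join G H = \<lparr>verts = Inl ` verts G \<union> Inr ` verts H,
     edges = (\<lambda>e. Inl ` e) ` edges G \<union> (\<lambda>e. Inr ` e) ` edges H
       \<union> {{Inl u, Inr v} | u v. u \<in> verts G \<and> v \<in> verts H}\<rparr>"

definition copies :: "nat \<Rightarrow> 'a sgraph \<Rightarrow> (nat \<times> 'a) sgraph" where
  "copies m H = \<lparr>verts = {..<m} \<times> verts H,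
     edges = {Pair i ` e | i e. i < m \<and> e \<in> edges H}\<rparr>"

definition complete_graph :: "nat \<Rightarrow> nat sgraph" where
  "complete_graph n = \<lparr>verts = {..<n}, edges = all_pairs {..<n}\<rparr>"

definition complete_bipartite :: "nat \<Rightarrow> nat \<Rightarrow> (nat + nat) sgraph" where
  "complete_bipartite s t = \<lparr>verts = Inl ` {..<s} \<union> Inr ` {..<t},
     edges = {{Inl i, Inr j} | i j. i < s \<and> j < t}\<rparr>"

definition path_graph :: "nat \<Rightarrow> nat sgraph" where
  "path_graph t = \<lparr>verts = {..<t}, edges = {{i, Suc i} | i. Suc i < t}\<rparr>"

text \<open>\<open>K\<^sub>n - PM\<close>, deleting the perfect matching \<open>{0, 1}, {2, 3}, \<dots>\<close>; intended for even \<open>n\<close> only.\<close>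
definition complete_minus_PM :: "nat \<Rightarrow> nat sgraph" where
  "complete_minus_PM n = \<lparr>verts = {..<n},
     edges = all_pairs {..<n} - {{2 * i, 2 * i + 1} | i. i < n div 2}\<rparr>"

text \<open>The \<open>p\<close> triangles \<open>0, 1, i\<close> share the edge \<open>{0, 1}\<close>; intended for \<open>p \<ge> 1\<close>.\<close>
definition book :: "nat \<Rightarrow> nat sgraph" where
  "book p = \<lparr>verts = {..<p + 2}, edges = (\<Union>i\<in>{2..<p + 2}. {{0, 1}, {0, i}, {1, i}})\<rparr>"

end

theory Submission imports Defs begin

text \<open>
  We work in the complement. An edge \<open>uv\<close> of a graph of order \<open>p + 3\<close> lies in fewer than \<open>p\<close>
  triangles iff \<open>u\<close> and \<open>v\<close> have together at least two neighbours in the complement, and one has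
  to minimise the degree sum of the complement subject to this condition. An isolated vertex of
  the complement forces all other degrees there to be at least 2, which is optimal only for
  \<open>p = 2\<close> (a 4-cycle). Without isolated vertices and for odd \<open>p\<close>, the minimum is a perfect
  matching. For even \<open>p\<close> some set \<open>S\<close> of vertices has degree at least 2. Two leaves
  never share their neighbour, so every vertex has at most one neighbour outside \<open>S\<close>; the
  total excess \<open>e\<close> of the degrees over 1 is odd by parity and satisfies
  \<open>|S| \<le> e \<le> |S| (|S| - 1)\<close>. Hence \<open>e \<ge> 3\<close>, with equality only if \<open>S\<close> consists of three
  vertices of degree 2, which form a triangle or the interior of a path on five vertices; the
  rest is a matching.
\<close>

section \<open>Neighbourhoods and degree sum in the complement\<close>

definition nonnbrs :: "'a sgraph \<Rightarrow> 'a \<Rightarrow> 'a set" where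
  "nonnbrs G v = {w \<in> verts G. w \<noteq> v \<and> {v, w} \<notin> edges G}"

definition codegree_sum :: "'a sgraph \<Rightarrow> nat" where
  "codegree_sum G = (\<Sum>v\<in>verts G. card (nonnbrs G v))"

text \<open>For an edge \<open>uv\<close> of a graph of order \<open>p + 3\<close>, the other
  \<open>p + 1\<close> vertices are common neighbours except those in this union, so the condition
  says that no edge lies in \<open>p\<close> triangles. It does not mention \<open>p\<close>, which
  lets it pass from the two sides of a join to the join.\<close>

definition spread :: "'a sgraph \<Rightarrow> bool" where
  "spread G \<longleftrightarrow> (\<forall>u\<in>verts G. \<forall>v\<in>verts G. {u, v} \<in> edges G \<longrightarrow>
     2 \<le> card (nonnbrs G u \<union> nonnbrs G v))"

lemma finite_nonnbrs [simp]: "simple_graph G \<Longrightarrow> finite (nonnbrs G v)"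
  by (simp add: nonnbrs_def simple_graph_def)

lemma nonnbrs_subset: "nonnbrs G v \<subseteq> verts G"
  by (auto simp: nonnbrs_def)

lemma not_in_own_nonnbrs [simp]: "v \<notin> nonnbrs G v"
  by (simp add: nonnbrs_def)

lemma nonnbrs_sym: "w \<in> nonnbrs G v \<Longrightarrow> v \<in> verts G \<Longrightarrow> v \<in> nonnbrs G w"
  by (auto simp: nonnbrs_def insert_commute)

lemma simple_graph_edge_distinct: "simple_graph G \<Longrightarrow> {u, v} \<in> edges G \<Longrightarrow> u \<noteq> v"
  by (fastforce simp: simple_graph_def)

lemma edge_iff_notin_nonnbrs:
  assumes "simple_graph G" "u \<in> verts G" "v \<in> verts G"
  shows "{u, v} \<in> edges G \<longleftrightarrow> u \<noteq> v \<and> v \<notin> nonnbrs G u"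
  using assms simple_graph_edge_distinct[OF assms(1)] by (auto simp: nonnbrs_def)

text \<open>The handshake count: at each vertex, degree and complement degree add up to the order
  minus one. Maximising the size is therefore minimising \<open>codegree_sum\<close>.\<close>

lemma codegree_sum_plus_size:
  assumes "simple_graph G"
  shows "codegree_sum G + 2 * graph_size G = graph_order G * (graph_order G - 1)"
proof -
  have fin: "finite (verts G)" using assms by (simp add: simple_graph_def)
  have finE: "finite (edges G)"
    using assms by (auto simp: simple_graph_def intro: finite_subset[of _ "Pow (verts G)"])
  have deg: "card (nonnbrs G v) + card {e \<in> edges G. v \<in> e} = graph_order G - 1"
    if v: "v \<in> verts G" for v
  proof -
    let ?A = "{w \<in> verts G. {v, w} \<in> edges G}"
    have "bij_betw (\<lambda>w. {v, w}) ?A {e \<in> edges G. v \<in> e}"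
    proof (rule bij_betw_imageI)
      show "inj_on (\<lambda>w. {v, w}) ?A" by (auto simp: inj_on_def doubleton_eq_iff)
      show "(\<lambda>w. {v, w}) ` ?A = {e \<in> edges G. v \<in> e}"
      proof (intro equalityI subsetI)
        fix e assume e: "e \<in> {e \<in> edges G. v \<in> e}"
        then have "e \<subseteq> verts G" "card e = 2" using assms by (auto simp: simple_graph_def)
        then obtain w where "e = {v, w}" using e by (auto simp: card_2_iff)
        with e \<open>e \<subseteq> verts G\<close> show "e \<in> (\<lambda>w. {v, w}) ` ?A" by auto
      qed auto
    qed
    then have "card {e \<in> edges G. v \<in> e} = card ?A" by (rule bij_betw_same_card[symmetric])
    moreover have "nonnbrs G v \<union> ?A = verts G - {v}" "nonnbrs G v \<inter> ?A = {}"
      using simple_graph_edge_distinct[OF assms] by (auto simp: nonnbrs_def)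
    then have "card (nonnbrs G v) + card ?A = card (verts G - {v})"
      using fin assms by (simp flip: card_Un_disjoint)
    ultimately show ?thesis using v fin by (simp add: graph_order_def)
  qed
  have "(\<Sum>v\<in>verts G. card {e \<in> edges G. v \<in> e}) = 2 * card (edges G)"
  proof (rule sum_multicount[OF fin finE])
    show "\<forall>e\<in>edges G. card {v \<in> verts G. v \<in> e} = 2"
    proof
      fix e assume "e \<in> edges G"
      then have "e \<subseteq> verts G" "card e = 2" using assms by (auto simp: simple_graph_def)
      moreover from this have "{v \<in> verts G. v \<in> e} = e" by auto
      ultimately show "card {v \<in> verts G. v \<in> e} = 2" by simp
    qed
  qed
  moreover have "codegree_sum G + (\<Sum>v\<in>verts G. card {e \<in> edges G. v \<in> e})
      = graph_order G * (graph_order G - 1)"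
    by (simp add: codegree_sum_def flip: sum.distrib) (simp add: deg graph_order_def)
  ultimately show ?thesis by (simp add: graph_size_def)
qed

subsection \<open>Isomorphisms\<close>

text \<open>Injectivity of \<open>f\<close> preserves distinctness of vertices, so preserving
  \<open>nonnbrs\<close> is enough to preserve edges. Through this rule the extremal graphs are
  recognised by their complements.\<close>

lemma graph_isoI:
  assumes "simple_graph G" "simple_graph H" and bij: "bij_betw f (verts G) (verts H)"
    and nn: "\<And>u v. u \<in> verts G \<Longrightarrow> v \<in> verts G \<Longrightarrow> v \<in> nonnbrs G u \<longleftrightarrow> f v \<in> nonnbrs H (f u)"
  shows "G \<simeq> H"
  unfolding graph_iso_def
proof (intro exI[of _ f] conjI bij ballI)
  fix u v assume uv: "u \<in> verts G" "v \<in> verts G"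
  then have "f u \<in> verts H" "f v \<in> verts H" "f u = f v \<longleftrightarrow> u = v"
    using bij by (auto simp: bij_betw_def inj_on_def)
  then show "{u, v} \<in> edges G \<longleftrightarrow> {f u, f v} \<in> edges H"
    using uv assms(1,2) nn by (simp add: edge_iff_notin_nonnbrs)
qed

lemma nonnbrs_iso:
  assumes "bij_betw f (verts G) (verts H)"
    and "\<forall>u\<in>verts G. \<forall>v\<in>verts G. {u, v} \<in> edges G \<longleftrightarrow> {f u, f v} \<in> edges H"
    and "v \<in> verts G"
  shows "nonnbrs H (f v) = f ` nonnbrs G v"
proof -
  have "verts H = f ` verts G" "inj_on f (verts G)" using assms by (auto simp: bij_betw_def)
  then show ?thesis using assms(2,3) by (auto simp: nonnbrs_def inj_on_def)
qed

lemma codegree_sum_iso: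
  assumes "G \<simeq> H"
  shows "codegree_sum G = codegree_sum H"
proof -
  obtain f where f: "bij_betw f (verts G) (verts H)"
    "\<forall>u\<in>verts G. \<forall>v\<in>verts G. {u, v} \<in> edges G \<longleftrightarrow> {f u, f v} \<in> edges H"
    using assms by (auto simp: graph_iso_def)
  have "card (nonnbrs H (f v)) = card (nonnbrs G v)" if "v \<in> verts G" for v
    unfolding nonnbrs_iso[OF f that]
    by (rule card_image) (meson bij_betw_def f(1) inj_on_subset nonnbrs_subset)
  then have "codegree_sum G = (\<Sum>v\<in>verts G. card (nonnbrs H (f v)))"
    by (simp add: codegree_sum_def)
  also have "\<dots> = codegree_sum H"
    unfolding codegree_sum_def by (rule sum.reindex_bij_betw[OF f(1)])
  finally show ?thesis .
qed

lemma spread_iso: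
  assumes "G \<simeq> H" "spread H"
  shows "spread G"
proof -
  obtain f where f: "bij_betw f (verts G) (verts H)"
    "\<forall>u\<in>verts G. \<forall>v\<in>verts G. {u, v} \<in> edges G \<longleftrightarrow> {f u, f v} \<in> edges H"
    using assms by (auto simp: graph_iso_def)
  show ?thesis
    unfolding spread_def
  proof (intro ballI impI)
    fix u v assume uv: "u \<in> verts G" "v \<in> verts G" "{u, v} \<in> edges G"
    then have "f u \<in> verts H" "f v \<in> verts H" "{f u, f v} \<in> edges H"
      using f by (auto simp: bij_betw_def)
    then have "2 \<le> card (nonnbrs H (f u) \<union> nonnbrs H (f v))"
      using assms(2) by (simp add: spread_def)
    also have "nonnbrs H (f u) \<union> nonnbrs H (f v) = f ` (nonnbrs G u \<union> nonnbrs G v)"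
      using uv by (simp add: nonnbrs_iso[OF f] image_Un)
    also have "card \<dots> = card (nonnbrs G u \<union> nonnbrs G v)"
      by (rule card_image) (meson Un_least bij_betw_def f(1) inj_on_subset nonnbrs_subset)
    finally show "2 \<le> card (nonnbrs G u \<union> nonnbrs G v)" .
  qed
qed

text \<open>Relabelling of vertices, meant for \<open>f\<close> injective on them. It serves twice:
  to move a graph to natural numbers, and to place a copy of the book inside a host graph.\<close>

definition image_graph :: "('a \<Rightarrow> 'b) \<Rightarrow> 'a sgraph \<Rightarrow> 'b sgraph" where
  "image_graph f G = \<lparr>verts = f ` verts G, edges = (`) f ` edges G\<rparr>"

lemma
  assumes "simple_graph G" and inj: "inj_on f (verts G)"
  shows simple_image_graph: "simple_graph (image_graph f G)"
    and image_graph_iso: "image_graph f G \<simeq> G"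
proof -
  show "simple_graph (image_graph f G)"
    using assms by (auto simp: simple_graph_def image_graph_def
        intro!: card_image[THEN trans] elim: inj_on_subset)
  let ?g = "the_inv_into (verts G) f"
  have "bij_betw ?g (f ` verts G) (verts G)"
    using inj by (simp add: bij_betw_the_inv_into inj_on_imp_bij_betw)
  moreover have "{f u, f v} \<in> (`) f ` edges G \<longleftrightarrow> {u, v} \<in> edges G"
    if "u \<in> verts G" "v \<in> verts G" for u v
  proof
    assume "{f u, f v} \<in> (`) f ` edges G"
    then obtain e where e: "e \<in> edges G" "f ` e = f ` {u, v}" by auto
    moreover have "e \<subseteq> verts G" using e assms(1) by (auto simp: simple_graph_def)
    ultimately have "e = {u, v}"
      using that inj inj_on_image_eq_iff[of f "verts G" e "{u, v}"] by simp
    with e show "{u, v} \<in> edges G" by simp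
  next
    assume "{u, v} \<in> edges G"
    then have "f ` {u, v} \<in> (`) f ` edges G" by blast
    then show "{f u, f v} \<in> (`) f ` edges G" by simp
  qed
  ultimately show "image_graph f G \<simeq> G"
    using inj by (auto simp: graph_iso_def image_graph_def the_inv_into_f_f intro!: exI[of _ ?g])
qed

text \<open>\<open>ex_number\<close> ranges over graphs on natural numbers, while the extremal
  graphs live on sums and products; this lemma makes them admissible.\<close>

lemma iso_nat_graph:
  fixes H :: "'b sgraph"
  assumes "simple_graph H"
  obtains G :: "nat sgraph" where "simple_graph G" "graph_order G = graph_order H" "G \<simeq> H"
proof -
  obtain f :: "'b \<Rightarrow> nat" where f: "inj_on f (verts H)"
    using assms by (metis finite_imp_inj_to_nat_seg simple_graph_def)
  show ?thesis
  proof (rule that[OF simple_image_graph[OF assms f] _ image_graph_iso[OF assms f]])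
    show "graph_order (image_graph f H) = graph_order H"
      using f by (simp add: graph_order_def image_graph_def card_image)
  qed
qed

subsection \<open>Books\<close>

lemma simple_book: "simple_graph (book p)"
  by (auto simp: simple_graph_def book_def card_insert_if)

text \<open>If the ends of an edge have at most one non-neighbour between them, deleting the ends
  and that vertex leaves at least \<open>p\<close> common neighbours, which are the pages of a book
  on this edge.\<close>

lemma spread_if_book_free:
  assumes G: "simple_graph G" "graph_order G = p + 3" and free: "\<not> contains_copy G (book p)"
  shows "spread G"
  unfolding spread_def
proof (intro ballI impI, rule ccontr)
  fix u v assume uv: "u \<in> verts G" "v \<in> verts G" "{u, v} \<in> edges G"
    and small: "\<not> 2 \<le> card (nonnbrs G u \<union> nonnbrs G v)"
  let ?N = "nonnbrs G u \<union> nonnbrs G v"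
  let ?C = "verts G - ({u, v} \<union> ?N)"
  have fin: "finite (verts G)" using G by (simp add: simple_graph_def)
  have "u \<noteq> v" using simple_graph_edge_distinct[OF G(1) uv(3)] .
  have "card ({u, v} \<union> ?N) \<le> 3"
    using card_Un_le[of "{u, v}" ?N] small \<open>u \<noteq> v\<close> by simp
  moreover have "card ?C = p + 3 - card ({u, v} \<union> ?N)"
    using uv nonnbrs_subset[of G] G fin
    by (subst card_Diff_subset) (auto simp: graph_order_def intro: finite_subset)
  ultimately have "p \<le> card ?C" by simp
  then obtain C where C: "C \<subseteq> ?C" "card C = p" "finite C"
    using obtain_subset_with_card_n by metis
  have "card {2..<p + 2} = card C" using C by simp
  then obtain g where g: "bij_betw g {2..<p + 2} C"
    using C(3) finite_same_card_bij by blast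
  \<comment> \<open>The embedding of the book: its common edge goes to \<open>u\<close>,
    \<open>v\<close>, the remaining vertices go to \<open>C\<close>.\<close>
  define f where "f i = (if i = 0 then u else if i = 1 then v else g i)" for i :: nat
  have gC: "g i \<in> ?C" if "2 \<le> i" "i < p + 2" for i
    using bij_betwE[OF g] that C(1) by (meson atLeastLessThan_iff subsetD)
  have inj: "inj_on f (verts (book p))"
  proof (rule inj_onI)
    fix i j assume "i \<in> verts (book p)" "j \<in> verts (book p)" "f i = f j"
    moreover have "g i = g j \<Longrightarrow> 2 \<le> i \<Longrightarrow> i < p + 2 \<Longrightarrow> 2 \<le> j \<Longrightarrow> j < p + 2 \<Longrightarrow> i = j"
      using g by (auto simp: bij_betw_def inj_on_def)
    ultimately show "i = j"
      using gC[of i] gC[of j] \<open>u \<noteq> v\<close> by (auto simp: f_def book_def split: if_splits)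
  qed
  have "subgraph_of (image_graph f (book p)) G"
    unfolding subgraph_of_def
  proof (intro conjI simple_image_graph simple_book inj)
    show "verts (image_graph f (book p)) \<subseteq> verts G"
      using gC uv by (auto simp: image_graph_def book_def f_def)
    have "{u, g i} \<in> edges G" "{v, g i} \<in> edges G" if "2 \<le> i" "i < p + 2" for i
      using gC[OF that] uv G(1) by (auto simp: edge_iff_notin_nonnbrs)
    then show "edges (image_graph f (book p)) \<subseteq> edges G"
      using uv by (auto simp: image_graph_def book_def f_def insert_commute)
  qed
  moreover have "image_graph f (book p) \<simeq> book p"
    by (rule image_graph_iso[OF simple_book inj])
  ultimately show False using free by (auto simp: contains_copy_def)
qed

text \<open>A copy of the book covers all but one of the \<open>p + 3\<close> vertices, and no
  vertex of the copy is a non-neighbour of an end of the common edge. So the ends have at most one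
  non-neighbour together.\<close>

lemma book_free_if_spread:
  assumes G: "simple_graph G" "graph_order G = p + 3" "spread G" and p: "p \<ge> 1"
  shows "\<not> contains_copy G (book p)"
proof
  assume "contains_copy G (book p)"
  then obtain K where K: "subgraph_of K G" "K \<simeq> book p" by (auto simp: contains_copy_def)
  from K(2) obtain f where "bij_betw f (verts K) (verts (book p)) \<and>
    (\<forall>u\<in>verts K. \<forall>v\<in>verts K. {u, v} \<in> edges K \<longleftrightarrow> {f u, f v} \<in> edges (book p))"
    unfolding graph_iso_def ..
  then have f: "bij_betw f (verts K) (verts (book p))"
    and e: "\<forall>u\<in>verts K. \<forall>v\<in>verts K. {u, v} \<in> edges K \<longleftrightarrow> {f u, f v} \<in> edges (book p)"
    by blast+
  have fin: "finite (verts G)" using G by (simp add: simple_graph_def)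
  have im: "f ` verts K = {..<p + 2}" using f by (simp add: bij_betw_def book_def)
  then have "0 \<in> f ` verts K" "1 \<in> f ` verts K" by auto
  then obtain u v where uv: "u \<in> verts K" "f u = 0" "v \<in> verts K" "f v = 1" by auto
  have KG: "edges K \<subseteq> edges G" "verts K \<subseteq> verts G" using K by (auto simp: subgraph_of_def)
  \<comment> \<open>This needs a page: \<open>book 0\<close> has no edge at all.\<close>
  have "{0, 1} \<in> edges (book p)" using p by (auto simp: book_def intro!: bexI[of _ 2])
  then have "{u, v} \<in> edges K" using bspec[OF bspec[OF e uv(1)] uv(3)] uv by simp
  then have "2 \<le> card (nonnbrs G u \<union> nonnbrs G v)"
    using G(3) uv KG by (auto simp: spread_def)
  moreover have "nonnbrs G u \<union> nonnbrs G v \<subseteq> verts G - verts K"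
  proof -
    have "w \<notin> nonnbrs G u \<union> nonnbrs G v" if w: "w \<in> verts K" for w
    proof (cases "w = u \<or> w = v")
      case True
      moreover have "{u, v} \<in> edges G" "{v, u} \<in> edges G"
        using \<open>{u, v} \<in> edges K\<close> KG by (auto simp: insert_commute)
      ultimately show ?thesis by (auto simp: nonnbrs_def)
    next
      case False
      then have "f w \<noteq> 0" "f w \<noteq> 1"
        using inj_on_eq_iff[OF bij_betw_imp_inj_on[OF f]] uv w by metis+
      moreover have "f w < p + 2" using im w by auto
      ultimately have "f w \<in> {2..<p + 2}" by simp
      then have "{0, f w} \<in> edges (book p)" "{1, f w} \<in> edges (book p)"
        unfolding book_def by force+
      then have "{u, w} \<in> edges K" "{v, w} \<in> edges K"
        using bspec[OF bspec[OF e uv(1)] w] bspec[OF bspec[OF e uv(3)] w] uv by simp_all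
      then show ?thesis using KG by (auto simp: nonnbrs_def)
    qed
    then show ?thesis using nonnbrs_subset[of G u] nonnbrs_subset[of G v] by blast
  qed
  then have "card (nonnbrs G u \<union> nonnbrs G v) \<le> card (verts G - verts K)"
    using fin by (simp add: card_mono)
  moreover have "card (verts G - verts K) = 1"
    using fin G(2) KG bij_betw_same_card[OF f]
    by (simp add: card_Diff_subset finite_subset graph_order_def book_def)
  ultimately show False by simp
qed

text \<open>The witness \<open>H\<close> attains the least codegree sum \<open>c\<close>, so its
  copy on natural numbers has the largest size. The additive form of the conclusion avoids halving
  and truncated subtraction.\<close>

lemma ex_number_codegree:
  assumes H: "simple_graph H" "graph_order H = p + 3" "spread H" "codegree_sum H = c"
    and p: "p \<ge> 1"
    and bound: "\<And>G :: nat sgraph. simple_graph G \<Longrightarrow> graph_order G = p + 3 \<Longrightarrow> spread G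
      \<Longrightarrow> c \<le> codegree_sum G"
  shows "2 * ex_number (p + 3) (book p) + c = (p + 3) * (p + 2)"
proof -
  let ?S = "{graph_size G | G :: nat sgraph.
     simple_graph G \<and> graph_order G = p + 3 \<and> \<not> contains_copy G (book p)}"
  obtain G :: "nat sgraph" where G: "simple_graph G" "graph_order G = graph_order H" "G \<simeq> H"
    using iso_nat_graph[OF H(1)] .
  have free: "\<not> contains_copy G (book p)"
    using G H p spread_iso by (intro book_free_if_spread) auto
  have sz: "c + 2 * graph_size G = (p + 3) * (p + 2)"
    using codegree_sum_plus_size[OF G(1)] G(2) H codegree_sum_iso[OF G(3)] by simp
  have "Max ?S = graph_size G"
  proof (rule Max_eqI)
    have le: "y \<le> graph_size G" if "y \<in> ?S" for y
    proof -
      obtain F :: "nat sgraph" where F: "y = graph_size F" "simple_graph F"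
          "graph_order F = p + 3" "\<not> contains_copy F (book p)"
        using \<open>y \<in> ?S\<close> by auto
      then have "c \<le> codegree_sum F" by (intro bound spread_if_book_free)
      then show ?thesis using codegree_sum_plus_size[OF F(2)] F sz by simp
    qed
    then show "\<And>y. y \<in> ?S \<Longrightarrow> y \<le> graph_size G" .
    \<comment> \<open>The upper bound on the sizes also yields the finiteness that
      \<open>Max\<close> requires.\<close>
    show "finite ?S" by (rule finite_subset[of _ "{..graph_size G}"]) (use le in auto)
    show "graph_size G \<in> ?S" using G H(2) free by auto
  qed
  then show ?thesis using sz by (simp add: ex_number_def)
qed

subsection \<open>The extremal graphs\<close>

lemma doubleton_in_all_pairs [simp]: "{u, v} \<in> all_pairs V \<longleftrightarrow> u \<in> V \<and> v \<in> V \<and> u \<noteq> v"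
  by (auto simp: all_pairs_def doubleton_eq_iff)

lemma simple_graph_all_pairs:
  "finite (verts G) \<Longrightarrow> edges G \<subseteq> all_pairs (verts G) \<Longrightarrow> simple_graph G"
  by (fastforce simp: simple_graph_def all_pairs_def)

lemma simple_complement: "simple_graph G \<Longrightarrow> simple_graph (complement G)"
  by (rule simple_graph_all_pairs) (auto simp: complement_def simple_graph_def)

lemma nonnbrs_complement:
  assumes "simple_graph G" "v \<in> verts G"
  shows "nonnbrs (complement G) v = {w. {v, w} \<in> edges G}"
  using assms simple_graph_edge_distinct[OF assms(1)]
  by (fastforce simp: nonnbrs_def complement_def simple_graph_def)

text \<open>All cross edges are present in a join, so its complement is the disjoint union of the
  complements of the two sides. Hence \<open>nonnbrs\<close> never crosses sides.\<close>

lemma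
  fixes G :: "'a sgraph" and H :: "'b sgraph"
  assumes G: "simple_graph G" and H: "simple_graph H"
  shows simple_join: "simple_graph (join G H)"
    and nonnbrs_join_Inl: "v \<in> verts G \<Longrightarrow> nonnbrs (join G H) (Inl v) = Inl ` nonnbrs G v"
    and nonnbrs_join_Inr: "w \<in> verts H \<Longrightarrow> nonnbrs (join G H) (Inr w) = Inr ` nonnbrs H w"
proof -
  have "card (Inl ` e :: ('a + 'b) set) = 2" "e \<subseteq> verts G" if "e \<in> edges G" for e
    using that G by (simp_all add: simple_graph_def card_image)
  moreover have "card (Inr ` e :: ('a + 'b) set) = 2" "e \<subseteq> verts H" if "e \<in> edges H" for e
    using that H by (simp_all add: simple_graph_def card_image)
  moreover have "finite (verts G)" "finite (verts H)" using assms by (simp_all add: simple_graph_def)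
  ultimately show "simple_graph (join G H)"
    unfolding simple_graph_def join_def by fastforce
  have l: "{Inl u, Inl v} \<in> edges (join G H) \<longleftrightarrow> {u, v} \<in> edges G" for u v
  proof
    assume "{Inl u, Inl v} \<in> edges (join G H)"
    then obtain e where e: "e \<in> edges G" "{Inl u, Inl v} = (Inl ` e :: ('a + 'b) set)"
      by (auto simp: join_def doubleton_eq_iff)
    have "Inl ` {u, v} = (Inl ` e :: ('a + 'b) set)" using e by simp
    then have "e = {u, v}" by (metis inj_Inl inj_image_eq_iff)
    then show "{u, v} \<in> edges G" using e by simp
  next
    assume "{u, v} \<in> edges G"
    then have "(Inl ` {u, v} :: ('a + 'b) set) \<in> (`) Inl ` edges G" by (rule imageI)
    then show "{Inl u, Inl v} \<in> edges (join G H)" by (simp add: join_def)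
  qed
  have r: "{Inr u, Inr v} \<in> edges (join G H) \<longleftrightarrow> {u, v} \<in> edges H" for u v
  proof
    assume "{Inr u, Inr v} \<in> edges (join G H)"
    then obtain e where e: "e \<in> edges H" "{Inr u, Inr v} = (Inr ` e :: ('a + 'b) set)"
      by (auto simp: join_def doubleton_eq_iff)
    have "Inr ` {u, v} = (Inr ` e :: ('a + 'b) set)" using e by simp
    then have "e = {u, v}" by (metis inj_Inr inj_image_eq_iff)
    then show "{u, v} \<in> edges H" using e by simp
  next
    assume "{u, v} \<in> edges H"
    then have "(Inr ` {u, v} :: ('a + 'b) set) \<in> (`) Inr ` edges H" by (rule imageI)
    then show "{Inr u, Inr v} \<in> edges (join G H)" by (simp add: join_def)
  qed
  have lr: "{Inl u, Inr v} \<in> edges (join G H)" "{Inr v, Inl u} \<in> edges (join G H)"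
    if "u \<in> verts G" "v \<in> verts H" for u v
    using that by (auto simp: join_def insert_commute)
  have V: "verts (join G H) = Inl ` verts G \<union> Inr ` verts H" by (simp add: join_def)
  show "v \<in> verts G \<Longrightarrow> nonnbrs (join G H) (Inl v) = Inl ` nonnbrs G v"
    using l lr by (auto simp: nonnbrs_def V)
  show "w \<in> verts H \<Longrightarrow> nonnbrs (join G H) (Inr w) = Inr ` nonnbrs H w"
    using r lr by (auto simp: nonnbrs_def V)
qed

lemma verts_join: "verts (join G H) = Inl ` verts G \<union> Inr ` verts H"
  by (simp add: join_def)

lemma
  assumes G: "simple_graph G" and H: "simple_graph H"
  shows order_join: "graph_order (join G H) = graph_order G + graph_order H"
    and codegree_sum_join: "codegree_sum (join G H) = codegree_sum G + codegree_sum H"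
proof -
  have fin: "finite (verts G)" "finite (verts H)" using assms by (auto simp: simple_graph_def)
  then show "graph_order (join G H) = graph_order G + graph_order H"
    by (subst graph_order_def, subst verts_join, subst card_Un_disjoint)
      (auto simp: card_image graph_order_def)
  have "codegree_sum (join G H) = (\<Sum>v\<in>Inl ` verts G. card (nonnbrs (join G H) v))
      + (\<Sum>v\<in>Inr ` verts H. card (nonnbrs (join G H) v))"
    unfolding codegree_sum_def verts_join using fin by (intro sum.union_disjoint) auto
  then show "codegree_sum (join G H) = codegree_sum G + codegree_sum H"
    using assms
    by (simp add: sum.reindex nonnbrs_join_Inl nonnbrs_join_Inr card_image codegree_sum_def)
qed

text \<open>Edges inside one side inherit the condition. The ends of a cross edge each contribute a
  non-neighbour on their own side, and these are different; this is where nonempty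
  \<open>nonnbrs\<close> enters.\<close>

lemma spread_join:
  assumes G: "simple_graph G" "spread G" "\<And>v. v \<in> verts G \<Longrightarrow> nonnbrs G v \<noteq> {}"
    and H: "simple_graph H" "spread H" "\<And>v. v \<in> verts H \<Longrightarrow> nonnbrs H v \<noteq> {}"
  shows "spread (join G H)"
  unfolding spread_def
proof (intro ballI impI)
  fix x y assume xy: "x \<in> verts (join G H)" "y \<in> verts (join G H)" "{x, y} \<in> edges (join G H)"
  have adj: "x \<noteq> y" "y \<notin> nonnbrs (join G H) x"
    using edge_iff_notin_nonnbrs[OF simple_join[OF G(1) H(1)] xy(1,2)] xy(3) by auto
  have mixed: "2 \<le> card (Inl ` nonnbrs G u \<union> Inr ` nonnbrs H v)"
    if "u \<in> verts G" "v \<in> verts H" for u v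
  proof -
    have "0 < card (nonnbrs G u)" "0 < card (nonnbrs H v)" using that G H by (simp_all add: card_gt_0_iff)
    moreover have "card (Inl ` nonnbrs G u \<union> Inr ` nonnbrs H v) = card (nonnbrs G u) + card (nonnbrs H v)"
      using G H by (subst card_Un_disjoint) (auto simp: card_image)
    ultimately show ?thesis by linarith
  qed
  consider (ll) u v where "x = Inl u" "y = Inl v" "u \<in> verts G" "v \<in> verts G"
    | (rr) u v where "x = Inr u" "y = Inr v" "u \<in> verts H" "v \<in> verts H"
    | (lr) u v where "x = Inl u" "y = Inr v" "u \<in> verts G" "v \<in> verts H"
    | (rl) u v where "x = Inr v" "y = Inl u" "u \<in> verts G" "v \<in> verts H"
    using xy(1,2) unfolding verts_join by blast
  then show "2 \<le> card (nonnbrs (join G H) x \<union> nonnbrs (join G H) y)"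
  proof cases
    case ll
    then have "{u, v} \<in> edges G" using adj G H
      by (auto simp: edge_iff_notin_nonnbrs nonnbrs_join_Inl)
    then have "2 \<le> card (nonnbrs G u \<union> nonnbrs G v)" using G(2) ll by (simp add: spread_def)
    then show ?thesis using ll G H by (simp add: nonnbrs_join_Inl card_image flip: image_Un)
  next
    case rr
    then have "{u, v} \<in> edges H" using adj G H
      by (auto simp: edge_iff_notin_nonnbrs nonnbrs_join_Inr)
    then have "2 \<le> card (nonnbrs H u \<union> nonnbrs H v)" using H(2) rr by (simp add: spread_def)
    then show ?thesis using rr G H by (simp add: nonnbrs_join_Inr card_image flip: image_Un)
  next
    case lr
    then show ?thesis using mixed G H by (simp add: nonnbrs_join_Inl nonnbrs_join_Inr)
  next
    case rl
    then show ?thesis using mixed G H by (simp add: nonnbrs_join_Inl nonnbrs_join_Inr Un_commute)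
  qed
qed

section \<open>Complete graphs minus a perfect matching\<close>

lemma simple_complete_minus_PM: "simple_graph (complete_minus_PM m)"
  by (rule simple_graph_all_pairs) (auto simp: complete_minus_PM_def)

lemma order_complete_minus_PM [simp]: "graph_order (complete_minus_PM m) = m"
  by (simp add: graph_order_def complete_minus_PM_def)

text \<open>The matched pairs are the fibres of division by 2. This is the form in which
  \<open>perfect_matching_enum\<close> delivers a matching.\<close>

lemma nonnbrs_complete_minus_PM_iff:
  assumes "even m" "i < m" "j < m"
  shows "j \<in> nonnbrs (complete_minus_PM m) i \<longleftrightarrow> i \<noteq> j \<and> i div 2 = j div 2"
proof -
  have "{i, j} \<in> {{2 * k, 2 * k + 1} | k. k < m div 2}" if "i \<noteq> j" "i div 2 = j div 2"
  proof -
    have "{i, j} = {2 * (i div 2), 2 * (i div 2) + 1}"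
      using that by (simp add: doubleton_eq_iff) presburger
    moreover have "i div 2 < m div 2" using assms by presburger
    ultimately show ?thesis by blast
  qed
  moreover have "i div 2 = j div 2" if "{i, j} \<in> {{2 * k, 2 * k + 1} | k. k < m div 2}"
    using that by (auto simp: doubleton_eq_iff)
  ultimately show ?thesis
    using assms by (auto simp: nonnbrs_def complete_minus_PM_def)
qed

lemma nonnbrs_complete_minus_PM:
  assumes "even m" "i < m"
  shows "nonnbrs (complete_minus_PM m) i = {if even i then i + 1 else i - 1}" (is "_ = {?j}")
proof -
  \<comment> \<open>Evenness of \<open>m\<close> keeps \<open>i + 1\<close> in range when
    \<open>i\<close> is even.\<close>
  have "?j < m" using assms by (auto elim!: evenE oddE)
  moreover have "j = ?j" if "i \<noteq> j" "i div 2 = j div 2" for j using that by auto presburger+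
  moreover have "i \<noteq> ?j" "i div 2 = ?j div 2" by (auto elim!: evenE oddE)
  moreover have "j < m" if "j \<in> nonnbrs (complete_minus_PM m) i" for j
    using that by (simp add: nonnbrs_def complete_minus_PM_def)
  ultimately show ?thesis
    using nonnbrs_complete_minus_PM_iff[OF assms] by blast
qed

lemma verts_complete_minus_PM [simp]: "verts (complete_minus_PM m) = {..<m}"
  by (simp add: complete_minus_PM_def)

lemma codegree_sum_complete_minus_PM: "even m \<Longrightarrow> codegree_sum (complete_minus_PM m) = m"
  by (simp add: codegree_sum_def nonnbrs_complete_minus_PM)

text \<open>Distinct vertices have distinct partners in a matching, so the two singletons of
  non-neighbours are different.\<close>

lemma spread_complete_minus_PM:
  assumes "even m"
  shows "spread (complete_minus_PM m)"
  unfolding spread_def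
proof (intro ballI impI)
  fix i j assume ij: "i \<in> verts (complete_minus_PM m)" "j \<in> verts (complete_minus_PM m)"
    "{i, j} \<in> edges (complete_minus_PM m)"
  have lt: "i < m" "j < m" using ij(1,2) by (simp_all add: complete_minus_PM_def)
  have ne: "i \<noteq> j" using simple_graph_edge_distinct[OF simple_complete_minus_PM ij(3)] .
  have "(if even i then i + 1 else i - 1) \<noteq> (if even j then j + 1 else j - 1)"
    using ne edge_iff_notin_nonnbrs[OF simple_complete_minus_PM ij(1,2)] ij(3)
      nonnbrs_complete_minus_PM_iff[OF assms lt] by simp presburger
  then show "2 \<le> card (nonnbrs (complete_minus_PM m) i \<union> nonnbrs (complete_minus_PM m) j)"
    using lt assms by (simp only: nonnbrs_complete_minus_PM) simp
qed

section \<open>The small building blocks and their codegree sums\<close>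

lemma simple_complete_graph: "simple_graph (complete_graph n)"
  by (rule simple_graph_all_pairs) (auto simp: complete_graph_def)

lemma simple_path_graph: "simple_graph (path_graph n)"
  by (rule simple_graph_all_pairs) (auto simp: path_graph_def)

lemma simple_copies:
  assumes "simple_graph H"
  shows "simple_graph (copies m H)"
  using assms by (force simp: simple_graph_def copies_def card_image inj_on_def)

lemma edges_copies_iff:
  fixes H :: "'a sgraph"
  shows "{(i, u), (j, v)} \<in> edges (copies m H) \<longleftrightarrow> i = j \<and> i < m \<and> {u, v} \<in> edges H"
proof
  assume "{(i, u), (j, v)} \<in> edges (copies m H)"
  then obtain k e where k: "{(i, u), (j, v)} = Pair k ` e" "k < m" "e \<in> edges H"
    unfolding copies_def by (simp only: sgraph.simps) blast
  have "(i, u) \<in> Pair k ` e" "(j, v) \<in> Pair k ` e" by (simp_all flip: k(1))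
  then have ij: "i = k" "j = k" by auto
  have inj: "inj (Pair k :: 'a \<Rightarrow> nat \<times> 'a)" by (simp add: inj_def)
  have "Pair k ` {u, v} = Pair k ` e" using k(1) ij by (simp only: image_insert image_empty)
  then have "{u, v} = e" unfolding inj_image_eq_iff[OF inj] .
  then show "i = j \<and> i < m \<and> {u, v} \<in> edges H" using k ij by simp
next
  assume *: "i = j \<and> i < m \<and> {u, v} \<in> edges H"
  have "{(i, u), (i, v)} = Pair i ` {u, v}" by simp
  then show "{(i, u), (j, v)} \<in> edges (copies m H)"
    unfolding copies_def using * by (simp only: sgraph.simps) blast
qed

lemma nonnbrs_copies:
  assumes "(i, u) \<in> verts (copies m H)"
  shows "nonnbrs (copies m H) (i, u)
    = {(j, v). j < m \<and> v \<in> verts H \<and> (j, v) \<noteq> (i, u) \<and> (i = j \<longrightarrow> {u, v} \<notin> edges H)}"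
  using assms by (auto simp: nonnbrs_def edges_copies_iff) (auto simp: copies_def)

lemma nonnbrs_copies_K1:
  "i < m \<Longrightarrow> nonnbrs (copies m (complete_graph 1)) (i, 0) = ({..<m} - {i}) \<times> {0}"
  by (subst nonnbrs_copies) (auto simp: copies_def complete_graph_def)

lemma verts_copies_K1: "verts (copies m (complete_graph 1)) = {..<m} \<times> {0}"
  by (auto simp: copies_def complete_graph_def)

lemma codegree_sum_copies_K1: "codegree_sum (copies m (complete_graph 1)) = m * (m - 1)"
proof -
  have "codegree_sum (copies m (complete_graph 1)) = (\<Sum>v\<in>{..<m} \<times> {0::nat}. m - 1)"
    unfolding codegree_sum_def verts_copies_K1
    by (rule sum.cong) (auto simp: nonnbrs_copies_K1 card_cartesian_product simp del: One_nat_def)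
  then show ?thesis by simp
qed

lemma spread_copies_K1: "spread (copies m (complete_graph 1))"
proof -
  have "edges (copies m (complete_graph 1)) = {}"
    by (auto simp: copies_def complete_graph_def all_pairs_def)
  then show ?thesis by (simp add: spread_def)
qed

lemma nonnbrs_complement_path:
  "i < n \<Longrightarrow> nonnbrs (complement (path_graph n)) i = {j. j < n \<and> (j = Suc i \<or> i = Suc j)}"
  using nonnbrs_complement[OF simple_path_graph, of i n] by (auto simp: path_graph_def doubleton_eq_iff)

lemma codegree_sum_complement_P5: "codegree_sum (complement (path_graph 5)) = 8"
proof -
  have "{..<5::nat} = {0, 1, 2, 3, 4}" by auto
  then have V: "verts (complement (path_graph 5)) = {0, 1, 2, 3, 4}"
    by (simp add: complement_def path_graph_def)
  have "nonnbrs (complement (path_graph 5)) 0 = {1}"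
    "nonnbrs (complement (path_graph 5)) 1 = {0, 2}"
    "nonnbrs (complement (path_graph 5)) 2 = {1, 3}"
    "nonnbrs (complement (path_graph 5)) 3 = {2, 4}"
    "nonnbrs (complement (path_graph 5)) 4 = {3}"
    by (auto simp: nonnbrs_complement_path)
  then show ?thesis unfolding codegree_sum_def V by simp
qed

lemma simple_complete_bipartite: "simple_graph (complete_bipartite s t)"
  by (rule simple_graph_all_pairs) (auto simp: complete_bipartite_def)

lemma nonnbrs_complete_bipartite:
  "i < s \<Longrightarrow> nonnbrs (complete_bipartite s t) (Inl i) = Inl ` ({..<s} - {i})"
  "j < t \<Longrightarrow> nonnbrs (complete_bipartite s t) (Inr j) = Inr ` ({..<t} - {j})"
  by (auto simp: nonnbrs_def complete_bipartite_def doubleton_eq_iff)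

lemma codegree_sum_complete_bipartite:
  "codegree_sum (complete_bipartite s t) = s * (s - 1) + t * (t - 1)"
proof -
  have "codegree_sum (complete_bipartite s t)
      = (\<Sum>v\<in>Inl ` {..<s}. card (nonnbrs (complete_bipartite s t) v))
      + (\<Sum>v\<in>Inr ` {..<t}. card (nonnbrs (complete_bipartite s t) v))"
    unfolding codegree_sum_def by (subst sum.union_disjoint[symmetric]) (auto simp: complete_bipartite_def)
  then show ?thesis by (simp add: sum.reindex nonnbrs_complete_bipartite card_image)
qed

text \<open>The complement of two disjoint edges is a 4-cycle, seen here as the complete bipartite
  graph whose classes are the two copies.\<close>

lemma nonnbrs_two_P2:
  assumes "x \<in> verts (copies 2 (path_graph 2))" "y \<in> verts (copies 2 (path_graph 2))"
  shows "y \<in> nonnbrs (copies 2 (path_graph 2)) x \<longleftrightarrow> fst x \<noteq> fst y"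
proof -
  obtain i a j b where "x = (i, a)" "y = (j, b)" by fastforce
  then show ?thesis using assms
    by (auto simp: nonnbrs_copies) (auto simp: copies_def path_graph_def doubleton_eq_iff)
qed

lemma codegree_sum_two_P2: "codegree_sum (copies 2 (path_graph 2)) = 8"
proof -
  have V: "verts (copies 2 (path_graph 2)) = {..<2} \<times> {..<2}"
    by (simp add: copies_def path_graph_def)
  have "card (nonnbrs (copies 2 (path_graph 2)) x) = 2" if "x \<in> {..<2} \<times> {..<2}" for x
  proof -
    \<comment> \<open>For an index below 2, \<open>1 - fst x\<close> is the index of the other
      copy.\<close>
    have "nonnbrs (copies 2 (path_graph 2)) x = {1 - fst x} \<times> {..<2}"
      using that nonnbrs_two_P2[of x] nonnbrs_subset[of "copies 2 (path_graph 2)" x]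
      unfolding V by auto presburger
    then show ?thesis by (simp add: card_cartesian_product)
  qed
  then show ?thesis unfolding codegree_sum_def V by simp
qed

subsection \<open>Recognising the extremal graphs\<close>

text \<open>Induction that splits off one matched pair at a time. It is stated for a relation
  because it is applied both to \<open>nonnbrs\<close> and to the edges of a graph.\<close>

lemma perfect_matching_enum:
  assumes "finite Y" "\<And>u v. R u v \<Longrightarrow> R v u" "\<And>u. \<not> R u u"
    and "\<forall>v\<in>Y. \<exists>w\<in>Y. \<forall>z\<in>Y. R v z \<longleftrightarrow> z = w"
  shows "even (card Y) \<and> (\<exists>h. bij_betw h Y {..<card Y} \<and>
    (\<forall>u\<in>Y. \<forall>v\<in>Y. R u v \<longleftrightarrow> u \<noteq> v \<and> h u div 2 = h v div (2::nat)))"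
  using assms(1,4)
proof (induction Y rule: finite_psubset_induct)
  case (psubset Y)
  show ?case
  proof (cases "Y = {}")
    case True
    then show ?thesis by (simp add: bij_betw_def)
  next
    case False
    then obtain v where v: "v \<in> Y" by blast
    then obtain w where w: "w \<in> Y" "\<And>z. z \<in> Y \<Longrightarrow> R v z \<longleftrightarrow> z = w" using psubset.prems by metis
    have Rw: "R w z \<longleftrightarrow> z = v" if "z \<in> Y" for z
      using psubset.prems w v that assms(2) by metis
    have vw: "v \<noteq> w" using w assms(3) by metis
    let ?Z = "Y - {v, w}"
    let ?m = "card ?Z"
    \<comment> \<open>The partners of \<open>v\<close> and \<open>w\<close> are each other, so the
      partner of a remaining element remains too.\<close>
    have "\<exists>y\<in>?Z. \<forall>z\<in>?Z. R x z \<longleftrightarrow> z = y" if x: "x \<in> ?Z" for x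
    proof -
      obtain y where y: "y \<in> Y" "\<And>z. z \<in> Y \<Longrightarrow> R x z \<longleftrightarrow> z = y" using psubset.prems x by blast
      have "R x y" using y by simp
      then have "R y x" by (rule assms(2))
      then have "y \<noteq> v" "y \<noteq> w" using w(2)[of x] Rw[of x] x by auto
      then show ?thesis using y by auto
    qed
    then have *: "even ?m \<and> (\<exists>h. bij_betw h ?Z {..<?m} \<and>
        (\<forall>u\<in>?Z. \<forall>v\<in>?Z. R u v \<longleftrightarrow> u \<noteq> v \<and> h u div 2 = h v div (2::nat)))"
      using v by (intro psubset.IH) auto
    then have ev: "even ?m" by (rule conjunct1)
    obtain h where h: "bij_betw h ?Z {..<?m}"
      and R: "\<forall>x\<in>?Z. \<forall>y\<in>?Z. R x y \<longleftrightarrow> x \<noteq> y \<and> h x div 2 = h y div 2"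
      using conjunct2[OF *] by (elim exE conjE) (rule that)
    have "card {v, w} \<le> card Y" using v w(1) psubset.hyps by (intro card_mono) auto
    then have card: "card Y = ?m + 2"
      using v w(1) vw by (simp add: card_Diff_subset)
    \<comment> \<open>The new pair gets the next two numbers. Since \<open>?m\<close> is even, they
      have the same half, and it exceeds the halves of all earlier numbers.\<close>
    define g where "g x = (if x = v then ?m else if x = w then ?m + 1 else h x)" for x
    have "bij_betw g ?Z {..<?m}"
      using h by (rule bij_betw_cong[THEN iffD1, rotated]) (auto simp: g_def)
    moreover have "bij_betw g {v, w} {?m, ?m + 1}"
      using vw by (auto simp: bij_betw_def g_def)
    ultimately have "bij_betw g (?Z \<union> {v, w}) ({..<?m} \<union> {?m, ?m + 1})"
      by (rule bij_betw_combine) auto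
    moreover have "?Z \<union> {v, w} = Y" using v w by auto
    moreover have "{..<?m} \<union> {?m, ?m + 1} = {..<card Y}" unfolding card by auto
    ultimately have bij: "bij_betw g Y {..<card Y}" by simp
    have lt: "h x div 2 < ?m div 2" if "x \<in> ?Z" for x
    proof -
      have "h x < ?m" using bij_betwE[OF h] that by simp
      then show ?thesis using ev by presburger
    qed
    have old: "\<not> R x v" "\<not> R x w" if "x \<in> ?Z" for x
      using that assms(2) w(2) Rw by auto
    have "(?m + 1) div 2 = ?m div 2" using ev by presburger
    then have "R x y \<longleftrightarrow> x \<noteq> y \<and> g x div 2 = g y div 2" if xy: "x \<in> Y" "y \<in> Y" for x y
    proof -
      consider "x \<in> ?Z" "y \<in> ?Z" | "x \<in> ?Z" "y \<in> {v, w}" | "x \<in> {v, w}" "y \<in> ?Z"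
        | "x \<in> {v, w}" "y \<in> {v, w}" using xy by blast
      then show ?thesis
      proof cases
        case 1
        then show ?thesis using R by (simp add: g_def)
      next
        case 2
        then show ?thesis using old[OF 2(1)] lt[OF 2(1)] \<open>(?m + 1) div 2 = ?m div 2\<close>
          by (auto simp: g_def)
      next
        case 3
        then show ?thesis using w(2) Rw lt[OF 3(2)] \<open>(?m + 1) div 2 = ?m div 2\<close>
          by (auto simp: g_def)
      next
        case 4
        then show ?thesis using w Rw v vw assms(3) \<open>(?m + 1) div 2 = ?m div 2\<close>
          by (auto simp: g_def)
      qed
    qed
    then show ?thesis using bij card ev by auto
  qed
qed

text \<open>A set \<open>X\<close> closed under \<open>nonnbrs\<close> is a union of components of
  the complement, and by symmetry so is the rest. Isomorphisms on the two parts then glue to one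
  onto a join.\<close>

lemma graph_iso_joinI:
  assumes G: "simple_graph G" and H: "simple_graph H" and K: "simple_graph K"
    and X: "X \<subseteq> verts G" "\<And>v. v \<in> X \<Longrightarrow> nonnbrs G v \<subseteq> X"
    and f: "bij_betw f X (verts H)"
      "\<And>u v. u \<in> X \<Longrightarrow> v \<in> X \<Longrightarrow> v \<in> nonnbrs G u \<longleftrightarrow> f v \<in> nonnbrs H (f u)"
    and h: "bij_betw h (verts G - X) (verts K)"
      "\<And>u v. u \<in> verts G - X \<Longrightarrow> v \<in> verts G - X \<Longrightarrow>
        v \<in> nonnbrs G u \<longleftrightarrow> h v \<in> nonnbrs K (h u)"
  shows "G \<simeq> join H K"
proof -
  define F where "F v = (if v \<in> X then Inl (f v) else Inr (h v))" for v
  have "bij_betw (Inl \<circ> f) X (Inl ` verts H)"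
    by (rule bij_betw_trans[OF f(1)]) (simp add: bij_betw_def)
  then have "bij_betw F X (Inl ` verts H)"
    by (rule bij_betw_cong[THEN iffD1, rotated]) (simp add: F_def)
  moreover have "bij_betw (Inr \<circ> h) (verts G - X) (Inr ` verts K)"
    by (rule bij_betw_trans[OF h(1)]) (simp add: bij_betw_def)
  then have "bij_betw F (verts G - X) (Inr ` verts K)"
    by (rule bij_betw_cong[THEN iffD1, rotated]) (simp add: F_def)
  ultimately have "bij_betw F (X \<union> (verts G - X)) (verts (join H K))"
    unfolding verts_join by (rule bij_betw_combine) auto
  then have "bij_betw F (verts G) (verts (join H K))"
    using X(1) by (simp add: Un_absorb1)
  then show ?thesis
  proof (rule graph_isoI[OF G simple_join[OF H K]])
    fix u v assume uv: "u \<in> verts G" "v \<in> verts G"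
    have fu: "f u \<in> verts H" if "u \<in> X" using bij_betwE[OF f(1)] that by blast
    have hu: "h u \<in> verts K" if "u \<notin> X" using bij_betwE[OF h(1)] that uv by blast
    show "v \<in> nonnbrs G u \<longleftrightarrow> F v \<in> nonnbrs (join H K) (F u)"
    proof (cases "u \<in> X")
      case True
      show ?thesis
      proof (cases "v \<in> X")
        case True
        then show ?thesis using \<open>u \<in> X\<close> f(2) fu H K
          by (simp add: F_def nonnbrs_join_Inl inj_image_mem_iff)
      next
        case False
        then have "v \<notin> nonnbrs G u" using X(2) \<open>u \<in> X\<close> by blast
        then show ?thesis using False \<open>u \<in> X\<close> fu H K by (auto simp: F_def nonnbrs_join_Inl)
      qed
    next
      case False
      show ?thesis
      proof (cases "v \<in> X")
        case True
        then have "v \<notin> nonnbrs G u" using X(2) \<open>u \<notin> X\<close> uv nonnbrs_sym by fast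
        then show ?thesis using True \<open>u \<notin> X\<close> hu H K by (auto simp: F_def nonnbrs_join_Inr)
      next
        case False
        then show ?thesis using \<open>u \<notin> X\<close> h(2) hu H K uv
          by (simp add: F_def nonnbrs_join_Inr inj_image_mem_iff)
      qed
    qed
  qed
qed

text \<open>As \<open>X\<close> is closed under \<open>nonnbrs\<close>, symmetry keeps the single
  non-neighbour of an outside vertex outside. The outer part of the complement is thus a perfect
  matching, which \<open>perfect_matching_enum\<close> numbers in pairs.\<close>

lemma matching_part:
  assumes G: "simple_graph G"
    and X: "X \<subseteq> verts G" "\<And>v. v \<in> X \<Longrightarrow> nonnbrs G v \<subseteq> X"
    and leaf: "\<And>v. v \<in> verts G - X \<Longrightarrow> card (nonnbrs G v) = 1"
  obtains h where "even (card (verts G - X))"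
    and "bij_betw h (verts G - X) (verts (complete_minus_PM (card (verts G - X))))"
    and "\<And>u v. u \<in> verts G - X \<Longrightarrow> v \<in> verts G - X \<Longrightarrow>
      v \<in> nonnbrs G u \<longleftrightarrow> h v \<in> nonnbrs (complete_minus_PM (card (verts G - X))) (h u)"
proof -
  let ?Y = "verts G - X"
  \<comment> \<open>The conjunct \<open>u \<in> verts G\<close> makes the relation symmetric on the
    whole type, as \<open>perfect_matching_enum\<close> demands.\<close>
  let ?R = "\<lambda>u v. u \<in> verts G \<and> v \<in> nonnbrs G u"
  have ex: "\<forall>v\<in>?Y. \<exists>w\<in>?Y. \<forall>z\<in>?Y. ?R v z \<longleftrightarrow> z = w"
  proof
    fix v assume v: "v \<in> ?Y"
    obtain w where w: "nonnbrs G v = {w}" using leaf[OF v] by (auto simp: card_1_singleton_iff)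
    then have "w \<in> verts G" using nonnbrs_subset[of G v] by simp
    moreover have "v \<in> nonnbrs G w" using nonnbrs_sym[of w G v] w v by simp
    then have "w \<notin> X" using X(2) v by blast
    ultimately show "\<exists>w\<in>?Y. \<forall>z\<in>?Y. ?R v z \<longleftrightarrow> z = w" using w v by auto
  qed
  have sym: "?R v u" if "?R u v" for u v
    using that nonnbrs_sym[of v G u] nonnbrs_subset[of G u] by blast
  have fin: "finite ?Y" using G by (simp add: simple_graph_def)
  have *: "even (card ?Y) \<and> (\<exists>h. bij_betw h ?Y {..<card ?Y} \<and>
    (\<forall>u\<in>?Y. \<forall>v\<in>?Y. ?R u v \<longleftrightarrow> u \<noteq> v \<and> h u div 2 = h v div (2::nat)))"
    by (rule perfect_matching_enum[OF fin sym _ ex]) simp_all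
  then have ev: "even (card ?Y)" by (rule conjunct1)
  obtain h where h: "bij_betw h ?Y {..<card ?Y}"
    and R: "\<forall>u\<in>?Y. \<forall>v\<in>?Y. ?R u v \<longleftrightarrow> u \<noteq> v \<and> h u div 2 = h v div 2"
    using conjunct2[OF *] by (elim exE conjE) (rule that)
  show thesis
  proof (rule that[of h])
    show "even (card ?Y)" by (rule ev)
    show "bij_betw h ?Y (verts (complete_minus_PM (card ?Y)))" using h by simp
    fix u v assume uv: "u \<in> ?Y" "v \<in> ?Y"
    have "h u < card ?Y" "h v < card ?Y" using bij_betwE[OF h] uv by auto
    moreover have "h u = h v \<longleftrightarrow> u = v" using inj_on_eq_iff[OF bij_betw_imp_inj_on[OF h]] uv by simp
    ultimately show "v \<in> nonnbrs G u \<longleftrightarrow> h v \<in> nonnbrs (complete_minus_PM (card ?Y)) (h u)"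
      using R uv nonnbrs_complete_minus_PM_iff[OF ev] by auto
  qed
qed

subsection \<open>Graphs of minimal codegree sum\<close>

text \<open>Two different leaves of the complement with the same neighbour \<open>w\<close> would be
  adjacent in \<open>G\<close> and have only \<open>w\<close> as non-neighbour together.\<close>

lemma leaf_neighbour_unique:
  assumes "simple_graph G" "spread G" "u \<in> verts G" "v \<in> verts G"
    and N: "nonnbrs G u = {w}" "nonnbrs G v = {w}"
  shows "u = v"
proof (rule ccontr)
  assume "u \<noteq> v"
  moreover have "v \<noteq> w" using N(2) not_in_own_nonnbrs[of v G] by auto
  ultimately have "{u, v} \<in> edges G" using assms by (simp add: edge_iff_notin_nonnbrs)
  then have "2 \<le> card (nonnbrs G u \<union> nonnbrs G v)" using assms(2-4) by (simp add: spread_def)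
  then show False using N by simp
qed

section \<open>Excess of the degrees when the complement has no isolated vertex\<close>

context
  fixes G :: "'a sgraph" and S :: "'a set"
  assumes simple: "simple_graph G" and spread: "spread G"
    and nonempty: "\<And>v. v \<in> verts G \<Longrightarrow> nonnbrs G v \<noteq> {}"
  defines S_def: "S \<equiv> {v \<in> verts G. 2 \<le> card (nonnbrs G v)}"
begin

lemma codegree_pos: "v \<in> verts G \<Longrightarrow> 0 < card (nonnbrs G v)"
  using nonempty simple by (simp add: card_gt_0_iff)

lemma leaf_nonnbrs: "v \<in> verts G - S \<Longrightarrow> card (nonnbrs G v) = 1"
  using codegree_pos[of v] by (auto simp: S_def)

text \<open>Non-neighbours of \<open>v\<close> outside \<open>S\<close> are leaves of the complement attached to \<open>v\<close>; two such
  leaves would violate \<open>spread\<close>.\<close>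
lemma codegree_le_Suc:
  assumes v: "v \<in> verts G"
  shows "card (nonnbrs G v) \<le> Suc (card (nonnbrs G v \<inter> S))"
proof -
  have leaf: "x \<in> verts G \<and> nonnbrs G x = {v}" if x: "x \<in> nonnbrs G v - S" for x
  proof -
    have xG: "x \<in> verts G" using x nonnbrs_subset[of G v] by blast
    then obtain w where w: "nonnbrs G x = {w}"
      using leaf_nonnbrs[of x] x by (auto simp: card_1_singleton_iff)
    then show ?thesis using nonnbrs_sym[of x G v] x v xG by auto
  qed
  have "card (nonnbrs G v - S) \<le> 1"
  proof (rule ccontr)
    assume "\<not> card (nonnbrs G v - S) \<le> 1"
    then obtain x y where "x \<in> nonnbrs G v - S" "y \<in> nonnbrs G v - S" "x \<noteq> y"
      using simple by (metis One_nat_def card_le_Suc0_iff_eq finite_Diff finite_nonnbrs)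
    then show False using leaf leaf_neighbour_unique[OF simple spread, of x y v] by auto
  qed
  moreover have "card (nonnbrs G v) = card (nonnbrs G v \<inter> S) + card (nonnbrs G v - S)"
    using simple by (subst card_Un_disjoint[symmetric]) (auto intro: arg_cong[of _ _ card])
  ultimately show ?thesis by simp
qed

lemma finite_S: "finite S"
  using simple by (simp add: S_def simple_graph_def)

text \<open>Every complement degree is at least 1, so the truncated subtraction is exact, and
  vertices outside \<open>S\<close> have excess 0.\<close>

lemma codegree_sum_excess: "codegree_sum G = graph_order G + (\<Sum>v\<in>S. card (nonnbrs G v) - 1)"
proof -
  have fin: "finite (verts G)" using simple by (simp add: simple_graph_def)
  have "codegree_sum G = (\<Sum>v\<in>verts G. 1 + (card (nonnbrs G v) - 1))"
    unfolding codegree_sum_def using codegree_pos by (intro sum.cong) (simp_all add: Suc_leI)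
  also have "\<dots> = graph_order G + (\<Sum>v\<in>verts G. card (nonnbrs G v) - 1)"
    by (simp only: sum.distrib) (simp add: graph_order_def)
  also have "(\<Sum>v\<in>verts G. card (nonnbrs G v) - 1) = (\<Sum>v\<in>S. card (nonnbrs G v) - 1)"
    using fin leaf_nonnbrs by (intro sum.mono_neutral_right) (auto simp: S_def)
  finally show ?thesis .
qed

text \<open>A vertex of \<open>S\<close> has at most \<open>card S - 1\<close> complement neighbours
  in \<open>S\<close> and, by \<open>codegree_le_Suc\<close>, at most one outside.\<close>

lemma excess_le: "(\<Sum>v\<in>S. card (nonnbrs G v) - 1) \<le> card S * (card S - 1)"
proof -
  have "card (nonnbrs G v) - 1 \<le> card S - 1" if v: "v \<in> S" for v
  proof -
    have "card (nonnbrs G v) - 1 \<le> card (nonnbrs G v \<inter> S)"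
      using codegree_le_Suc[of v] v by (simp add: S_def)
    also have "\<dots> \<le> card (S - {v})" using finite_S by (intro card_mono) auto
    finally show ?thesis using v finite_S by simp
  qed
  then have "(\<Sum>v\<in>S. card (nonnbrs G v) - 1) \<le> (\<Sum>v\<in>S. card S - 1)" by (rule sum_mono)
  then show ?thesis by simp
qed

lemma le_excess: "card S \<le> (\<Sum>v\<in>S. card (nonnbrs G v) - 1)"
proof -
  have "(\<Sum>v\<in>S. 1) \<le> (\<Sum>v\<in>S. card (nonnbrs G v) - 1)" by (rule sum_mono) (auto simp: S_def)
  then show ?thesis by simp
qed

text \<open>Excess 1 would leave at most one vertex in \<open>S\<close>, and then
  \<open>excess_le\<close> makes the excess 0.\<close>

lemma codegree_sum_ne_Suc: "codegree_sum G \<noteq> Suc (graph_order G)"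
proof
  assume "codegree_sum G = Suc (graph_order G)"
  then have "(\<Sum>v\<in>S. card (nonnbrs G v) - 1) = 1" using codegree_sum_excess by simp
  then have "card S \<le> 1" "1 \<le> card S * (card S - 1)" using le_excess excess_le by simp_all
  moreover have "card S = 0 \<or> card S = 1" using \<open>card S \<le> 1\<close> by linarith
  ultimately show False by auto
qed

text \<open>The two bounds on the excess exclude \<open>card S \<le> 2\<close>, since 2 times 1 is
  below 3. Three vertices with excess at least 1 each and total 3 have excess exactly 1.\<close>

lemma excess_three:
  assumes "codegree_sum G = graph_order G + 3"
  shows "card S = 3" and "\<And>v. v \<in> S \<Longrightarrow> card (nonnbrs G v) = 2"
proof -
  have e: "(\<Sum>v\<in>S. card (nonnbrs G v) - 1) = 3" using codegree_sum_excess assms by simp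
  have "card S \<le> 3" "3 \<le> card S * (card S - 1)" using le_excess excess_le unfolding e by simp_all
  moreover have "card S = 0 \<or> card S = 1 \<or> card S = 2 \<or> card S = 3"
    using \<open>card S \<le> 3\<close> by linarith
  ultimately show S3: "card S = 3" by auto
  have "(\<Sum>v\<in>S. card (nonnbrs G v) - 1) = (\<Sum>v\<in>S. 1 + (card (nonnbrs G v) - 2))"
    by (rule sum.cong) (auto simp: S_def)
  then have "(\<Sum>v\<in>S. card (nonnbrs G v) - 2) = 0"
    unfolding e by (simp only: sum.distrib) (simp add: S3)
  then have "\<forall>v\<in>S. card (nonnbrs G v) - 2 = 0" using finite_S by simp
  then show "card (nonnbrs G v) = 2" if "v \<in> S" for v
    using that by (fastforce simp: S_def)
qed

text \<open>In the complement, suppose \<open>a\<close> and \<open>c\<close> in \<open>S\<close> are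
  not adjacent. Each has degree 2 and a neighbour in \<open>S\<close>, so both are joined to the
  third vertex \<open>b\<close>, which exhausts the degree of \<open>b\<close>. The second
  neighbours \<open>x\<close> and \<open>y\<close> of \<open>a\<close> and \<open>c\<close> are
  leaves and end the path.\<close>

lemma triangle_or_P5:
  assumes cs: "codegree_sum G = graph_order G + 3"
  shows "(\<forall>u\<in>S. nonnbrs G u = S - {u}) \<or>
    (\<exists>x a b c y. distinct [x, a, b, c, y] \<and> S = {a, b, c} \<and> {x, y} \<subseteq> verts G \<and>
      nonnbrs G x = {a} \<and> nonnbrs G a = {x, b} \<and> nonnbrs G b = {a, c} \<and>
      nonnbrs G c = {b, y} \<and> nonnbrs G y = {c})"
proof (cases "\<forall>u\<in>S. nonnbrs G u = S - {u}")
  case False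
  note S3 = excess_three[OF cs]
  have SG: "S \<subseteq> verts G" by (auto simp: S_def)
  obtain a where a: "a \<in> S" "nonnbrs G a \<noteq> S - {a}" using False by blast
  have "\<not> S - {a} \<subseteq> nonnbrs G a"
  proof
    assume "S - {a} \<subseteq> nonnbrs G a"
    moreover have "card (S - {a}) = card (nonnbrs G a)" using S3 a finite_S by simp
    ultimately show False using a(2) card_subset_eq[of "nonnbrs G a" "S - {a}"] simple by simp
  qed
  then obtain c where c: "c \<in> S" "c \<noteq> a" "c \<notin> nonnbrs G a" by blast
  have "card (S - {a, c}) = 1" using S3(1) a c finite_S by (simp add: card_Diff_subset)
  then obtain b where b: "S - {a, c} = {b}" by (auto simp: card_1_singleton_iff)
  then have S: "S = {a, b, c}" and bac: "b \<noteq> a" "b \<noteq> c" using a c by auto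
  \<comment> \<open>By \<open>codegree_le_Suc\<close>, at most one of the two non-neighbours lies
    outside \<open>S\<close>.\<close>
  have meets: "nonnbrs G v \<inter> S \<noteq> {}" if "v \<in> S" for v
    using codegree_le_Suc[of v] S3(2)[OF that] that SG by auto
  have "a \<notin> nonnbrs G c" using c a SG nonnbrs_sym[of a G c] by blast
  then have cb: "b \<in> nonnbrs G c" using meets[OF c(1)] not_in_own_nonnbrs[of c G] unfolding S by auto
  have ab: "b \<in> nonnbrs G a" using meets[OF a(1)] c not_in_own_nonnbrs[of a G] unfolding S by auto
  have N2: "\<exists>x. nonnbrs G v = {b, x} \<and> x \<noteq> b \<and> x \<in> verts G" if "v \<in> S" "b \<in> nonnbrs G v" for v
  proof -
    have "card (nonnbrs G v - {b}) = 1" using that S3(2) simple by simp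
    then obtain x where "nonnbrs G v - {b} = {x}" by (auto simp: card_1_singleton_iff)
    then have "nonnbrs G v = {b, x}" "x \<noteq> b" using that by auto
    then show ?thesis using nonnbrs_subset[of G v] by auto
  qed
  obtain x where x: "nonnbrs G a = {b, x}" "x \<noteq> b" "x \<in> verts G" using N2[OF a(1) ab] by blast
  obtain y where y: "nonnbrs G c = {b, y}" "y \<noteq> b" "y \<in> verts G" using N2[OF c(1) cb] by blast
  have "x \<notin> S" using x c not_in_own_nonnbrs[of a G] unfolding S by auto
  then have "card (nonnbrs G x) = 1" using leaf_nonnbrs x by simp
  moreover have "a \<in> nonnbrs G x" using nonnbrs_sym[of x G a] x a SG by auto
  ultimately have Nx: "nonnbrs G x = {a}" by (auto simp: card_1_singleton_iff)
  have "y \<notin> S" using y \<open>a \<notin> nonnbrs G c\<close> not_in_own_nonnbrs[of c G] unfolding S by auto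
  then have "card (nonnbrs G y) = 1" using leaf_nonnbrs y by simp
  moreover have "c \<in> nonnbrs G y" using nonnbrs_sym[of y G c] y c SG by auto
  ultimately have Ny: "nonnbrs G y = {c}" by (auto simp: card_1_singleton_iff)
  have "{a, c} \<subseteq> nonnbrs G b"
    using nonnbrs_sym[of b G a] nonnbrs_sym[of b G c] ab cb a c SG by auto
  moreover have "card (nonnbrs G b) = 2" using S3(2) S by simp
  ultimately have Nb: "nonnbrs G b = {a, c}"
    using card_subset_eq[OF finite_nonnbrs[OF simple], of "{a, c}" b] c by simp
  have "x \<noteq> y" using Nx Ny c by auto
  then have "distinct [x, a, b, c, y]" using \<open>x \<notin> S\<close> \<open>y \<notin> S\<close> bac c(2) unfolding S by auto
  moreover have "nonnbrs G a = {x, b}" using x(1) by (simp add: insert_commute)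
  moreover have "{x, y} \<subseteq> verts G" using x(3) y(3) by simp
  ultimately show ?thesis using S Nx Ny Nb y(1)
    by (intro disjI2 exI[of _ x] exI[of _ a] exI[of _ b] exI[of _ c] exI[of _ y] conjI)
qed simp

end

section \<open>The least codegree sum and the extremal number\<close>

lemma codegree_ge_2_if_isolated:
  assumes "simple_graph G" "spread G" "u \<in> verts G" "nonnbrs G u = {}" "v \<in> verts G" "v \<noteq> u"
  shows "2 \<le> card (nonnbrs G v)"
proof -
  have "{u, v} \<in> edges G" using assms by (simp add: edge_iff_notin_nonnbrs)
  then have "2 \<le> card (nonnbrs G u \<union> nonnbrs G v)"
    using assms(2,3,5) unfolding spread_def by blast
  then show ?thesis using assms(4) by simp
qed

text \<open>Every other vertex is adjacent in \<open>G\<close> to \<open>u\<close>, which has no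
  non-neighbours, so it must supply two by itself.\<close>

lemma codegree_sum_ge_if_isolated:
  assumes "simple_graph G" "spread G" "u \<in> verts G" "nonnbrs G u = {}"
  shows "2 * (graph_order G - 1) \<le> codegree_sum G"
proof -
  have fin: "finite (verts G)" using assms by (simp add: simple_graph_def)
  have "codegree_sum G = (\<Sum>v\<in>verts G - {u}. card (nonnbrs G v))"
    unfolding codegree_sum_def using fin assms by (simp add: sum.remove[of _ u])
  also have "(\<Sum>v\<in>verts G - {u}. 2) \<le> \<dots>"
    using codegree_ge_2_if_isolated[OF assms] by (intro sum_mono) simp
  finally show ?thesis using assms(3) fin by (simp add: graph_order_def)
qed

lemma even_codegree_sum:
  assumes "simple_graph G"
  shows "even (codegree_sum G)"
proof -
  have "even (codegree_sum G + 2 * graph_size G)"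
    unfolding codegree_sum_plus_size[OF assms] by auto
  then show ?thesis by simp
qed

text \<open>An isolated vertex of the complement gives \<open>2 * (p + 2)\<close>, which is large
  enough because an even positive \<open>p\<close> is at least 2. Otherwise the sum is at least the
  order; for even \<open>p\<close> the order is odd and the sum is even, so the excess is odd, and
  it is not 1.\<close>

lemma codegree_sum_lower_bound:
  assumes G: "simple_graph G" "spread G" "graph_order G = p + 3" and p: "p \<ge> 1"
  shows "(if odd p then p + 3 else p + 6) \<le> codegree_sum G"
proof (cases "\<exists>u\<in>verts G. nonnbrs G u = {}")
  case True
  then have "2 * (p + 2) \<le> codegree_sum G" using codegree_sum_ge_if_isolated[OF G(1,2)] G(3) by auto
  moreover have "p \<ge> 2" if "even p" using that p by presburger
  ultimately show ?thesis by auto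
next
  case False
  then have *: "codegree_sum G \<noteq> Suc (graph_order G)" "graph_order G \<le> codegree_sum G"
    using codegree_sum_ne_Suc[OF G(1,2)] codegree_sum_excess[OF G(1,2)] by auto
  show ?thesis using * even_codegree_sum[OF G(1)] unfolding G(3) by presburger
qed

text \<open>Here \<open>p + 3\<close> is even, so the complement can be a perfect matching, which
  meets the lower bound.\<close>

lemma ex_number_book_odd:
  assumes "odd p" "p \<ge> 1"
  shows "2 * ex_number (p + 3) (book p) + (p + 3) = (p + 3) * (p + 2)"
proof (rule ex_number_codegree[of "complete_minus_PM (p + 3)"])
  show "codegree_sum (complete_minus_PM (p + 3)) = p + 3" "spread (complete_minus_PM (p + 3))"
    using assms by (simp_all add: codegree_sum_complete_minus_PM spread_complete_minus_PM)
  show "p + 3 \<le> codegree_sum F" if "simple_graph F" "graph_order F = p + 3" "spread F"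
    for F :: "nat sgraph" using codegree_sum_lower_bound[of F p] that assms by simp
qed (use assms in \<open>simp_all add: simple_complete_minus_PM\<close>)

lemma simple_copies_K1: "simple_graph (copies m (complete_graph 1))"
  by (rule simple_copies[OF simple_complete_graph])

lemma codegree_sum_three_K1_join:
  assumes "even p"
  shows "codegree_sum (join (copies 3 (complete_graph 1)) (complete_minus_PM p)) = p + 6"
  using assms codegree_sum_copies_K1[of 3]
  by (simp add: codegree_sum_join simple_complete_minus_PM simple_copies_K1
      codegree_sum_complete_minus_PM del: One_nat_def)

text \<open>A triangle plus a matching in the complement meets the lower bound. One witness covers
  all even \<open>p\<close>: for \<open>p = 2\<close> it is the complete bipartite graph with
  classes of sizes 3 and 2.\<close>

lemma ex_number_book_even:
  assumes "even p" "p \<ge> 1"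
  shows "2 * ex_number (p + 3) (book p) + (p + 6) = (p + 3) * (p + 2)"
proof (rule ex_number_codegree[of "join (copies 3 (complete_graph 1)) (complete_minus_PM p)"])
  let ?A = "copies 3 (complete_graph 1)" and ?B = "complete_minus_PM p"
  have ord: "graph_order ?A = 3"
    unfolding graph_order_def verts_copies_K1 by (simp add: card_cartesian_product)
  show "simple_graph (join ?A ?B)" by (rule simple_join[OF simple_copies_K1 simple_complete_minus_PM])
  show "graph_order (join ?A ?B) = p + 3"
    unfolding order_join[OF simple_copies_K1 simple_complete_minus_PM] ord by simp
  show "codegree_sum (join ?A ?B) = p + 6" by (rule codegree_sum_three_K1_join[OF assms(1)])
  show "spread (join ?A ?B)"
  proof (rule spread_join[OF simple_copies_K1 spread_copies_K1 _ simple_complete_minus_PM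
        spread_complete_minus_PM[OF assms(1)]])
    show "nonnbrs ?A v \<noteq> {}" if v: "v \<in> verts ?A" for v
    proof -
      obtain i where i: "v = (i, 0)" "i < 3" using v unfolding verts_copies_K1 by blast
      have "(if i = 0 then 1 else 0) \<in> {..<3} - {i}" by simp
      then show ?thesis unfolding i(1) nonnbrs_copies_K1[OF i(2)] by blast
    qed
    show "nonnbrs ?B v \<noteq> {}" if "v \<in> verts ?B" for v
      using that assms by (simp add: nonnbrs_complete_minus_PM)
  qed
  show "p + 6 \<le> codegree_sum F" if "simple_graph F" "graph_order F = p + 3" "spread F"
    for F :: "nat sgraph" using codegree_sum_lower_bound[of F p] that assms by simp
qed (rule assms)

lemma graph_size_eq_iff_codegree_sum:
  assumes "simple_graph G" "graph_order G = p + 3" "2 * m + c = (p + 3) * (p + 2)"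
  shows "graph_size G = m \<longleftrightarrow> codegree_sum G = c"
  using codegree_sum_plus_size[OF assms(1)] assms(2,3) by auto

section \<open>Isomorphism types of the graphs attaining the bound\<close>

lemma iso_complete_minus_PM:
  assumes G: "simple_graph G" "spread G" "codegree_sum G = graph_order G" "graph_order G \<ge> 3"
  shows "G \<simeq> complete_minus_PM (graph_order G)"
proof -
  have fin: "finite (verts G)" using G by (simp add: simple_graph_def)
  \<comment> \<open>With order n, an empty \<open>nonnbrs G v\<close> would give
    \<open>2 * (n - 1) \<le> n\<close>, which fails for n at least 3.\<close>
  have ne: "nonnbrs G v \<noteq> {}" if "v \<in> verts G" for v
    using codegree_sum_ge_if_isolated[OF G(1,2) that] G(3,4) by auto
  have "(\<Sum>v\<in>verts G. card (nonnbrs G v) - 1) = 0"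
  proof -
    have "codegree_sum G = (\<Sum>v\<in>verts G. 1 + (card (nonnbrs G v) - 1))"
      unfolding codegree_sum_def using codegree_pos[OF G(1,2)] ne
      by (intro sum.cong) (simp_all add: Suc_leI)
    then show ?thesis using G(3) by (simp only: sum.distrib) (simp add: graph_order_def)
  qed
  then have zero: "\<forall>v\<in>verts G. card (nonnbrs G v) - 1 = 0" using fin by simp
  have leaf: "card (nonnbrs G v) = 1" if "v \<in> verts G - {}" for v
  proof -
    have "v \<in> verts G" using that by simp
    then show ?thesis using bspec[OF zero, of v] codegree_pos[OF G(1,2) ne, of v] by linarith
  qed
  \<comment> \<open>With the empty set as closed part, the matching is the whole complement.\<close>
  show ?thesis
  proof (rule matching_part[OF G(1) empty_subsetI _ leaf])
    fix h assume "bij_betw h (verts G - {}) (verts (complete_minus_PM (card (verts G - {}))))"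
      and "\<And>u v. u \<in> verts G - {} \<Longrightarrow> v \<in> verts G - {} \<Longrightarrow>
        v \<in> nonnbrs G u \<longleftrightarrow> h v \<in> nonnbrs (complete_minus_PM (card (verts G - {}))) (h u)"
    then show ?thesis
      unfolding graph_order_def by (intro graph_isoI[OF G(1) simple_complete_minus_PM]) simp_all
  qed simp_all
qed

text \<open>Recasts \<open>triangle_or_P5\<close> as a part \<open>X\<close> closed under
  \<open>nonnbrs\<close> with only leaves of the complement outside. For the triangle
  \<open>X\<close> is the set of vertices of complement degree at least 2; for the path the two end
  leaves are added.\<close>

lemma triangle_or_P5_decomposition:
  assumes G: "simple_graph G" "spread G" "codegree_sum G = graph_order G + 3"
    and ne: "\<And>v. v \<in> verts G \<Longrightarrow> nonnbrs G v \<noteq> {}"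
  obtains (triangle) X where "X \<subseteq> verts G" "card X = 3" "\<And>v. v \<in> X \<Longrightarrow> nonnbrs G v = X - {v}"
      "\<And>v. v \<in> verts G - X \<Longrightarrow> card (nonnbrs G v) = 1"
  | (P5) X f where "X \<subseteq> verts G" "\<And>v. v \<in> X \<Longrightarrow> nonnbrs G v \<subseteq> X"
      "\<And>v. v \<in> verts G - X \<Longrightarrow> card (nonnbrs G v) = 1"
      "bij_betw f X {..<5}"
      "\<And>u v. u \<in> X \<Longrightarrow> v \<in> X \<Longrightarrow>
        v \<in> nonnbrs G u \<longleftrightarrow> f v \<in> nonnbrs (complement (path_graph 5)) (f u)"
proof -
  let ?S = "{v \<in> verts G. 2 \<le> card (nonnbrs G v)}"
  have "card ?S = 3" by (rule excess_three(1)[OF G(1,2) ne G(3)])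
  have leaf: "card (nonnbrs G v) = 1" if "v \<in> verts G - ?S" for v
    by (rule leaf_nonnbrs[OF G(1,2) ne that])
  from triangle_or_P5[OF G(1,2) ne G(3)] show thesis
  proof
    assume *: "\<forall>u\<in>?S. nonnbrs G u = ?S - {u}"
    show thesis
    proof (rule triangle[of ?S])
      show "?S \<subseteq> verts G" by blast
      show "nonnbrs G v = ?S - {v}" if "v \<in> ?S" for v using * that by (rule bspec)
    qed (fact \<open>card ?S = 3\<close>, rule leaf)
  next
    assume "\<exists>x a b c y. distinct [x, a, b, c, y] \<and> ?S = {a, b, c} \<and> {x, y} \<subseteq> verts G \<and>
      nonnbrs G x = {a} \<and> nonnbrs G a = {x, b} \<and> nonnbrs G b = {a, c} \<and>
      nonnbrs G c = {b, y} \<and> nonnbrs G y = {c}"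
    then obtain x a b c y where d: "distinct [x, a, b, c, y]" and S: "?S = {a, b, c}"
      and xy: "{x, y} \<subseteq> verts G"
      and N: "nonnbrs G x = {a}" "nonnbrs G a = {x, b}" "nonnbrs G b = {a, c}"
        "nonnbrs G c = {b, y}" "nonnbrs G y = {c}"
      by (elim exE conjE) (rule that)
    \<comment> \<open>The positions along the path. The default 4 serves \<open>y\<close> and keeps
      all values below 5.\<close>
    define f where "f v = (if v = x then 0 else if v = a then 1 else if v = b then 2
      else if v = c then 3 else (4::nat))" for v
    have f: "f x = 0" "f a = 1" "f b = 2" "f c = 3" "f y = 4" using d by (auto simp: f_def)
    let ?X = "{x, a, b, c, y}"
    have SG: "?S \<subseteq> verts G" by blast
    show thesis
    proof (rule P5[of ?X f])
      show "?X \<subseteq> verts G" using SG xy unfolding S by simp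
      show "nonnbrs G v \<subseteq> ?X" if "v \<in> ?X" for v using that N by auto
      show "card (nonnbrs G v) = 1" if "v \<in> verts G - ?X" for v
        using leaf[of v] that unfolding S by simp
      have "f ` ?X = {0, 1, 2, 3, 4}" using f by simp
      also have "\<dots> = {..<5}" by auto
      finally show "bij_betw f ?X {..<5}" using d f by (auto simp: bij_betw_def inj_on_def)
      have *: "f v < 5" for v by (simp add: f_def)
      show "v \<in> nonnbrs G u \<longleftrightarrow> f v \<in> nonnbrs (complement (path_graph 5)) (f u)"
        if "u \<in> ?X" "v \<in> ?X" for u v
        unfolding nonnbrs_complement_path[OF *]
        using that d by (elim insertE emptyE) (auto simp: f N)
    qed
  qed
qed

text \<open>Any bijection will do, since all pairs in a complete part look alike.\<close>

lemma triangle_enum: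
  assumes "card X = 3" "\<And>v. v \<in> X \<Longrightarrow> nonnbrs G v = X - {v}"
  obtains g where "bij_betw g X {..<3::nat}"
    and "\<And>u v. u \<in> X \<Longrightarrow> v \<in> X \<Longrightarrow> v \<in> nonnbrs G u \<longleftrightarrow> g v \<noteq> g u"
proof -
  have "finite X" using assms(1) by (simp add: card_ge_0_finite)
  then obtain g where g: "bij_betw g X {..<3::nat}"
    using finite_same_card_bij[of X "{..<3::nat}"] assms(1) by auto
  moreover have "v \<in> nonnbrs G u \<longleftrightarrow> g v \<noteq> g u" if "u \<in> X" "v \<in> X" for u v
    using that assms(2) inj_on_eq_iff[OF bij_betw_imp_inj_on[OF g]] by simp
  ultimately show thesis by (rule that)
qed

text \<open>In the complement \<open>X\<close> is a triangle component, so it is an independent set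
  in \<open>G\<close> joined to everything else, and the rest is matched.\<close>

lemma iso_three_K1_join:
  assumes G: "simple_graph G" and X: "X \<subseteq> verts G" "card X = 3" "\<And>v. v \<in> X \<Longrightarrow> nonnbrs G v = X - {v}"
    and leaf: "\<And>v. v \<in> verts G - X \<Longrightarrow> card (nonnbrs G v) = 1"
  shows "G \<simeq> join (copies 3 (complete_graph 1)) (complete_minus_PM (card (verts G - X)))"
proof -
  have closed: "nonnbrs G v \<subseteq> X" if "v \<in> X" for v using X(3)[OF that] by blast
  obtain g where g: "bij_betw g X {..<3::nat}"
    and gn: "\<And>u v. u \<in> X \<Longrightarrow> v \<in> X \<Longrightarrow> v \<in> nonnbrs G u \<longleftrightarrow> g v \<noteq> g u"
    by (rule triangle_enum[OF X(2,3)], assumption) (rule that)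
  obtain h where h: "bij_betw h (verts G - X) (verts (complete_minus_PM (card (verts G - X))))"
    "\<And>u v. u \<in> verts G - X \<Longrightarrow> v \<in> verts G - X \<Longrightarrow>
      v \<in> nonnbrs G u \<longleftrightarrow> h v \<in> nonnbrs (complete_minus_PM (card (verts G - X))) (h u)"
    by (rule matching_part[OF G X(1) closed leaf], assumption, assumption) (rule that)
  show ?thesis
  proof (rule graph_iso_joinI[OF G simple_copies_K1 simple_complete_minus_PM X(1) closed _ _ h])
    have "bij_betw (\<lambda>i. (i, 0::nat)) {..<3::nat} ({..<3} \<times> {0})"
      by (auto simp: bij_betw_def inj_on_def)
    from bij_betw_trans[OF g this]
    show "bij_betw (\<lambda>v. (g v, 0)) X (verts (copies 3 (complete_graph 1)))"
      unfolding verts_copies_K1 by (simp add: comp_def)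
    fix u v assume uv: "u \<in> X" "v \<in> X"
    then have "g u < 3" "g v < 3" using bij_betwE[OF g] by auto
    then show "v \<in> nonnbrs G u \<longleftrightarrow> (g v, 0) \<in> nonnbrs (copies 3 (complete_graph 1)) (g u, 0)"
      unfolding gn[OF uv] nonnbrs_copies_K1[OF \<open>g u < 3\<close>] by simp
  qed
qed

lemma iso_complement_P5_join:
  assumes G: "simple_graph G" and X: "X \<subseteq> verts G" "\<And>v. v \<in> X \<Longrightarrow> nonnbrs G v \<subseteq> X"
    and leaf: "\<And>v. v \<in> verts G - X \<Longrightarrow> card (nonnbrs G v) = 1"
    and f: "bij_betw f X {..<5}"
      "\<And>u v. u \<in> X \<Longrightarrow> v \<in> X \<Longrightarrow>
        v \<in> nonnbrs G u \<longleftrightarrow> f v \<in> nonnbrs (complement (path_graph 5)) (f u)"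
  shows "G \<simeq> join (complement (path_graph 5)) (complete_minus_PM (card (verts G - X)))"
proof -
  obtain h where h: "bij_betw h (verts G - X) (verts (complete_minus_PM (card (verts G - X))))"
    "\<And>u v. u \<in> verts G - X \<Longrightarrow> v \<in> verts G - X \<Longrightarrow>
      v \<in> nonnbrs G u \<longleftrightarrow> h v \<in> nonnbrs (complete_minus_PM (card (verts G - X))) (h u)"
    by (rule matching_part[OF G X leaf], assumption, assumption) (rule that)
  have "verts (complement (path_graph 5)) = {..<5}" by (simp add: complement_def path_graph_def)
  then show ?thesis
    using f by (intro graph_iso_joinI[OF G simple_complement[OF simple_path_graph]
          simple_complete_minus_PM X _ _ h]) simp_all
qed

text \<open>Only two vertices lie outside \<open>X\<close>, and their single non-neighbours must be
  each other. The complement is a triangle and a disjoint edge, which is the complement of the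
  target.\<close>

lemma iso_K23:
  assumes G: "simple_graph G" "graph_order G = 5"
    and X: "X \<subseteq> verts G" "card X = 3" "\<And>v. v \<in> X \<Longrightarrow> nonnbrs G v = X - {v}"
    and leaf: "\<And>v. v \<in> verts G - X \<Longrightarrow> card (nonnbrs G v) = 1"
  shows "G \<simeq> complete_bipartite 2 3"
proof -
  let ?Y = "verts G - X"
  have fin: "finite (verts G)" using G by (simp add: simple_graph_def)
  then have "finite X" "finite ?Y" using X(1) finite_subset by auto
  have cY: "card ?Y = 2" using G(2) X fin \<open>finite X\<close> by (simp add: card_Diff_subset graph_order_def)
  obtain g where g: "bij_betw g X {..<3::nat}"
    and gn: "\<And>u v. u \<in> X \<Longrightarrow> v \<in> X \<Longrightarrow> v \<in> nonnbrs G u \<longleftrightarrow> g v \<noteq> g u"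
    by (rule triangle_enum[OF X(2,3)], assumption) (rule that)
  obtain h where h: "bij_betw h ?Y {..<2::nat}"
    using finite_same_card_bij[of ?Y "{..<2::nat}"] cY \<open>finite ?Y\<close> by auto
  have YX: "v \<notin> nonnbrs G u" "u \<notin> nonnbrs G v" if "u \<in> X" "v \<in> ?Y" for u v
    using that X(3)[of u] nonnbrs_sym[of u G v] X(1) by auto
  \<comment> \<open>Inclusion holds because \<open>X\<close> is closed, and both sides have one
    element.\<close>
  have Y: "nonnbrs G v = ?Y - {v}" if v: "v \<in> ?Y" for v
  proof (rule card_subset_eq)
    show "nonnbrs G v \<subseteq> ?Y - {v}"
      using nonnbrs_subset[of G v] YX(2)[OF _ v] not_in_own_nonnbrs[of v G] by blast
    show "card (nonnbrs G v) = card (?Y - {v})" using leaf[OF v] cY v \<open>finite ?Y\<close> by simp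
  qed (use \<open>finite ?Y\<close> in simp)
  \<comment> \<open>\<open>X\<close> goes to the right because the second class of the target has
    three vertices.\<close>
  define F where "F v = (if v \<in> X then Inr (g v) else Inl (h v))" for v
  have "bij_betw (Inr \<circ> g) X (Inr ` {..<3})"
    by (rule bij_betw_trans[OF g]) (simp add: bij_betw_def)
  then have "bij_betw F X (Inr ` {..<3})"
    by (rule bij_betw_cong[THEN iffD1, rotated]) (simp add: F_def)
  moreover have "bij_betw (Inl \<circ> h) ?Y (Inl ` {..<2})"
    by (rule bij_betw_trans[OF h]) (simp add: bij_betw_def)
  then have "bij_betw F ?Y (Inl ` {..<2})"
    by (rule bij_betw_cong[THEN iffD1, rotated]) (simp add: F_def)
  ultimately have "bij_betw F (X \<union> ?Y) (Inr ` {..<3} \<union> Inl ` {..<2})"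
    by (rule bij_betw_combine) auto
  moreover have "X \<union> ?Y = verts G" using X(1) by blast
  moreover have "Inr ` {..<3} \<union> Inl ` {..<2} = verts (complete_bipartite 2 3)"
    unfolding complete_bipartite_def by (simp add: Un_commute)
  ultimately have "bij_betw F (verts G) (verts (complete_bipartite 2 3))" by (simp only:)
  then show ?thesis
  proof (rule graph_isoI[OF G(1) simple_complete_bipartite])
    fix u v assume uv: "u \<in> verts G" "v \<in> verts G"
    show "v \<in> nonnbrs G u \<longleftrightarrow> F v \<in> nonnbrs (complete_bipartite 2 3) (F u)"
    proof (cases "u \<in> X")
      case True
      then have "g u < 3" using bij_betwE[OF g] by auto
      have N: "nonnbrs (complete_bipartite 2 3) (F u) = Inr ` ({..<3} - {g u})"
        using True nonnbrs_complete_bipartite(2)[OF \<open>g u < 3\<close>] by (simp add: F_def)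
      show ?thesis
      proof (cases "v \<in> X")
        case True
        then have "g v < 3" using bij_betwE[OF g] by auto
        then show ?thesis unfolding N gn[OF \<open>u \<in> X\<close> True] using True
          by (auto simp: F_def)
      next
        case False
        then show ?thesis unfolding N using YX(1)[OF \<open>u \<in> X\<close>] uv by (auto simp: F_def)
      qed
    next
      case False
      then have u: "u \<in> ?Y" using uv by simp
      then have "h u < 2" using bij_betwE[OF h] by auto
      have N: "nonnbrs (complete_bipartite 2 3) (F u) = Inl ` ({..<2} - {h u})"
        using False nonnbrs_complete_bipartite(1)[OF \<open>h u < 2\<close>] by (simp add: F_def)
      show ?thesis
      proof (cases "v \<in> X")
        case True
        then show ?thesis unfolding N using YX(2)[OF True u] by (auto simp: F_def)
      next
        case False
        then have v: "v \<in> ?Y" using uv by simp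
        then have "h v < 2" using bij_betwE[OF h] by auto
        moreover have "h v = h u \<longleftrightarrow> v = u" by (rule inj_on_eq_iff[OF bij_betw_imp_inj_on[OF h] v u])
        ultimately show ?thesis unfolding N Y[OF u] using v by (auto simp: F_def)
      qed
    qed
  qed
qed

text \<open>The other four vertices have complement degree at least 2 and total 8, hence exactly 2.
  Each then has exactly one neighbour in \<open>G\<close> among them, so they induce two disjoint
  edges.\<close>

lemma iso_K1_join_two_P2:
  assumes G: "simple_graph G" "spread G" "graph_order G = 5" "codegree_sum G = 8"
    and x: "x \<in> verts G" "nonnbrs G x = {}"
  shows "G \<simeq> join (complete_graph 1) (copies 2 (path_graph 2))"
proof -
  let ?W = "verts G - {x}"
  have fin: "finite (verts G)" using G by (simp add: simple_graph_def)
  have cW: "card ?W = 4" using G(3) x fin by (simp add: graph_order_def)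
  have ge: "2 \<le> card (nonnbrs G v)" if "v \<in> ?W" for v
    using codegree_ge_2_if_isolated[OF G(1,2) x] that by simp
  have "8 = (\<Sum>v\<in>?W. card (nonnbrs G v))"
    using G(4) fin x by (simp add: codegree_sum_def sum.remove[of _ x])
  also have "\<dots> = (\<Sum>v\<in>?W. 2 + (card (nonnbrs G v) - 2))"
    by (rule sum.cong[OF refl]) (metis ge le_add_diff_inverse)
  also have "\<dots> = 8 + (\<Sum>v\<in>?W. card (nonnbrs G v) - 2)"
    by (simp only: sum.distrib) (simp add: cW)
  finally have "(\<Sum>v\<in>?W. card (nonnbrs G v) - 2) = 0" by simp
  then have "card (nonnbrs G v) - 2 = 0" if "v \<in> ?W" for v using fin that by simp
  then have two: "card (nonnbrs G v) = 2" if "v \<in> ?W" for v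
    using ge[OF that] that by (meson diff_is_0_eq le_antisym)
  have NW: "nonnbrs G v \<subseteq> ?W - {v}" if "v \<in> ?W" for v
    using nonnbrs_subset[of G v] nonnbrs_sym[of x G v] x that not_in_own_nonnbrs[of v G] by auto
  \<comment> \<open>This time the matching consists of edges of \<open>G\<close> itself, not of the
    complement.\<close>
  let ?R = "\<lambda>u v. {u, v} \<in> edges G"
  have adj: "?R u v \<longleftrightarrow> u \<noteq> v \<and> v \<notin> nonnbrs G u" if "u \<in> ?W" "v \<in> ?W" for u v
    using that G(1) by (simp add: edge_iff_notin_nonnbrs)
  have ex: "\<forall>v\<in>?W. \<exists>w\<in>?W. \<forall>z\<in>?W. ?R v z \<longleftrightarrow> z = w"
  proof
    fix v assume v: "v \<in> ?W"
    have "card (?W - {v} - nonnbrs G v) = 1"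
      using NW[OF v] two[OF v] v cW fin G(1) by (simp add: card_Diff_subset)
    then obtain w where w: "?W - {v} - nonnbrs G v = {w}" by (auto simp: card_1_singleton_iff)
    have "?R v z \<longleftrightarrow> z \<in> ?W - {v} - nonnbrs G v" if "z \<in> ?W" for z
      using adj[OF v that] that by auto
    then show "\<exists>w\<in>?W. \<forall>z\<in>?W. ?R v z \<longleftrightarrow> z = w" unfolding w using w by blast
  qed
  have sym: "?R v u" if "?R u v" for u v using that by (simp add: insert_commute)
  have irr: "\<not> ?R u u" for u using simple_graph_edge_distinct[OF G(1), of u u] by auto
  have *: "even (card ?W) \<and> (\<exists>h. bij_betw h ?W {..<card ?W} \<and>
    (\<forall>u\<in>?W. \<forall>v\<in>?W. ?R u v \<longleftrightarrow> u \<noteq> v \<and> h u div 2 = h v div (2::nat)))"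
    by (rule perfect_matching_enum[OF finite_Diff[OF fin] sym irr ex])
  obtain h where h: "bij_betw h ?W {..<4::nat}"
    and R: "\<forall>u\<in>?W. \<forall>v\<in>?W. ?R u v \<longleftrightarrow> u \<noteq> v \<and> h u div 2 = h v div 2"
    using conjunct2[OF *] unfolding cW by (elim exE conjE) (rule that)
  \<comment> \<open>Matched vertices carry numbers with the same half, so the half names the copy of
    the edge and the parity the end in it.\<close>
  have "bij_betw (\<lambda>k::nat. (k div 2, k mod 2)) {..<4} ({..<2} \<times> {..<2})"
    by (rule bij_betw_byWitness[where f' = "\<lambda>(i, j). 2 * i + j"]) auto
  from bij_betw_trans[OF h this]
  have k: "bij_betw (\<lambda>v. (h v div 2, h v mod 2)) ?W ({..<2} \<times> {..<2})" by (simp add: comp_def)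
  have V: "verts (copies 2 (path_graph 2)) = {..<2} \<times> {..<2}"
    by (simp add: copies_def path_graph_def)
  show ?thesis
  proof (rule graph_iso_joinI[OF G(1) simple_complete_graph simple_copies[OF simple_path_graph],
        where X = "{x}" and f = "\<lambda>_. 0" and h = "\<lambda>v. (h v div 2, h v mod 2)"])
    show "bij_betw (\<lambda>v. (h v div 2, h v mod 2)) ?W (verts (copies 2 (path_graph 2)))"
      unfolding V by (rule k)
    fix u v assume uv: "u \<in> ?W" "v \<in> ?W"
    have "v \<in> nonnbrs G u \<longleftrightarrow> u \<noteq> v \<and> \<not> ?R u v"
      using adj[OF uv] NW[OF uv(1)] by auto
    also have "\<dots> \<longleftrightarrow> h u div 2 \<noteq> h v div 2" using R uv by auto
    also have "\<dots> \<longleftrightarrow> (h v div 2, h v mod 2) \<in> nonnbrs (copies 2 (path_graph 2)) (h u div 2, h u mod 2)"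
      using bij_betwE[OF k] uv by (subst nonnbrs_two_P2) (simp_all add: V)
    finally show "v \<in> nonnbrs G u \<longleftrightarrow>
      (h v div 2, h v mod 2) \<in> nonnbrs (copies 2 (path_graph 2)) (h u div 2, h u mod 2)" .
  qed (use x in \<open>auto simp: complete_graph_def bij_betw_def nonnbrs_def\<close>)
qed

theorem theorem5:
  fixes p :: nat and G :: "'a sgraph"
  assumes "p \<ge> 1"
    and "simple_graph G"
    and "graph_order G = p + 3"
    and "\<not> contains_copy G (book p)"
  shows "(p = 2 \<longrightarrow>
      (graph_size G = ex_number (p + 3) (book p) \<longleftrightarrow>
        G \<simeq> join (complete_graph 1) (copies 2 (path_graph 2)) \<or>
        G \<simeq> complete_bipartite 2 3 \<or>
        G \<simeq> complement (path_graph 5))) \<and>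
    (even p \<and> p \<ge> 4 \<longrightarrow>
      (graph_size G = ex_number (p + 3) (book p) \<longleftrightarrow>
        G \<simeq> join (copies 3 (complete_graph 1)) (complete_minus_PM p) \<or>
        G \<simeq> join (complement (path_graph 5)) (complete_minus_PM (p - 2)))) \<and>
    (odd p \<longrightarrow>
      (graph_size G = ex_number (p + 3) (book p) \<longleftrightarrow>
        G \<simeq> complete_minus_PM (p + 3)))"
proof -
  note p = assms(1) and G = assms(2) and ord = assms(3)
  have fin: "finite (verts G)" using G by (simp add: simple_graph_def)
  have spr: "spread G" by (rule spread_if_book_free[OF assms(2-4)])
  have odd: "graph_size G = ex_number (p + 3) (book p) \<longleftrightarrow> codegree_sum G = p + 3" if "odd p"
    by (rule graph_size_eq_iff_codegree_sum[OF G ord ex_number_book_odd[OF that p]])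
  have even: "graph_size G = ex_number (p + 3) (book p) \<longleftrightarrow> codegree_sum G = p + 6" if "even p"
    by (rule graph_size_eq_iff_codegree_sum[OF G ord ex_number_book_even[OF that p]])
  have card: "card (verts G - X) = p + 3 - card X" if "X \<subseteq> verts G" for X
    using that ord finite_subset[OF that fin] by (simp add: card_Diff_subset graph_order_def)
  \<comment> \<open>For \<open>p = 2\<close> the path uses all five vertices and no matching part is
    left.\<close>
  have P5_2: "G \<simeq> complement (path_graph 5)" if "p = 2"
    and X: "X \<subseteq> verts G" "bij_betw f X {..<5}" and f: "\<And>u v. u \<in> X \<Longrightarrow> v \<in> X \<Longrightarrow>
      v \<in> nonnbrs G u \<longleftrightarrow> f v \<in> nonnbrs (complement (path_graph 5)) (f u)" for X f
  proof -
    have "card X = 5" using bij_betw_same_card[OF X(2)] by simp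
    then have "X = verts G"
      using card_subset_eq[OF fin X(1)] ord \<open>p = 2\<close> by (simp add: graph_order_def)
    moreover have "verts (complement (path_graph 5)) = {..<5}"
      by (simp add: complement_def path_graph_def)
    ultimately show ?thesis
      using X f by (intro graph_isoI[OF G simple_complement[OF simple_path_graph]]) simp_all
  qed
  have "G \<simeq> join (complete_graph 1) (copies 2 (path_graph 2)) \<or>
      G \<simeq> complete_bipartite 2 3 \<or> G \<simeq> complement (path_graph 5)"
    if p2: "p = 2" and cs: "codegree_sum G = p + 6"
  proof (cases "\<exists>x\<in>verts G. nonnbrs G x = {}")
    \<comment> \<open>For \<open>p = 2\<close> the bound \<open>2 * (p + 2)\<close> from an isolated
      vertex of the complement equals \<open>p + 6\<close>, so this case does occur.\<close>
    case True
    then show ?thesis using iso_K1_join_two_P2[OF G spr] ord cs p2 by auto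
  next
    case False
    have cs': "codegree_sum G = graph_order G + 3" using cs ord by simp
    show ?thesis
    proof (rule triangle_or_P5_decomposition[OF G spr cs'])
      show "nonnbrs G v \<noteq> {}" if "v \<in> verts G" for v using False that by blast
    next
      fix X assume "X \<subseteq> verts G" "card X = 3" "\<And>v. v \<in> X \<Longrightarrow> nonnbrs G v = X - {v}"
        "\<And>v. v \<in> verts G - X \<Longrightarrow> card (nonnbrs G v) = 1"
      then have "G \<simeq> complete_bipartite 2 3" using ord p2 by (intro iso_K23[OF G]) simp_all
      then show ?thesis by simp
    next
      fix X f assume "X \<subseteq> verts G" "bij_betw f X {..<5}" "\<And>u v. u \<in> X \<Longrightarrow> v \<in> X \<Longrightarrow>
        v \<in> nonnbrs G u \<longleftrightarrow> f v \<in> nonnbrs (complement (path_graph 5)) (f u)"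
      then show ?thesis using P5_2[OF p2] by blast
    qed
  qed
  \<comment> \<open>For the converse it suffices to evaluate the isomorphism invariant
    \<open>codegree_sum\<close> on the listed graphs.\<close>
  moreover have "codegree_sum G = 8" if "p = 2"
    and "G \<simeq> join (complete_graph 1) (copies 2 (path_graph 2)) \<or>
      G \<simeq> complete_bipartite 2 3 \<or> G \<simeq> complement (path_graph 5)"
  proof -
    have "codegree_sum (complete_graph 1) = 0"
      by (auto simp: codegree_sum_def complete_graph_def nonnbrs_def)
    then have "codegree_sum (join (complete_graph 1) (copies 2 (path_graph 2))) = 8"
      by (simp only: codegree_sum_join[OF simple_complete_graph simple_copies[OF simple_path_graph]]
          codegree_sum_two_P2)
    moreover have "codegree_sum (complete_bipartite 2 3) = 8"
      by (simp add: codegree_sum_complete_bipartite)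
    ultimately show ?thesis
      using that(2) codegree_sum_complement_P5 by (auto dest!: codegree_sum_iso simp del: One_nat_def)
  qed
  moreover have "G \<simeq> join (copies 3 (complete_graph 1)) (complete_minus_PM p) \<or>
      G \<simeq> join (complement (path_graph 5)) (complete_minus_PM (p - 2))"
    if "p \<ge> 4" and cs: "codegree_sum G = p + 6"
  proof (rule triangle_or_P5_decomposition[OF G spr])
    show "codegree_sum G = graph_order G + 3" using cs ord by simp
    \<comment> \<open>An isolated vertex of the complement would force
      \<open>2 * (p + 2) \<le> p + 6\<close>, impossible for \<open>p \<ge> 4\<close>.\<close>
    show "nonnbrs G v \<noteq> {}" if "v \<in> verts G" for v
      using codegree_sum_ge_if_isolated[OF G spr that] cs ord \<open>p \<ge> 4\<close> by auto
  next
    fix X assume X: "X \<subseteq> verts G" "card X = 3" "\<And>v. v \<in> X \<Longrightarrow> nonnbrs G v = X - {v}"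
      "\<And>v. v \<in> verts G - X \<Longrightarrow> card (nonnbrs G v) = 1"
    show ?thesis using iso_three_K1_join[OF G X] card[OF X(1)] X(2) by (simp del: One_nat_def)
  next
    fix X f assume X: "X \<subseteq> verts G" "\<And>v. v \<in> X \<Longrightarrow> nonnbrs G v \<subseteq> X"
      "\<And>v. v \<in> verts G - X \<Longrightarrow> card (nonnbrs G v) = 1" "bij_betw f X {..<5}"
      "\<And>u v. u \<in> X \<Longrightarrow> v \<in> X \<Longrightarrow>
        v \<in> nonnbrs G u \<longleftrightarrow> f v \<in> nonnbrs (complement (path_graph 5)) (f u)"
    have "card X = 5" using bij_betw_same_card[OF X(4)] by simp
    then have "card (verts G - X) = p - 2" using card[OF X(1)] by simp
    then show ?thesis using iso_complement_P5_join[OF G X] by simp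
  qed
  moreover have "codegree_sum G = p + 6" if "even p" "p \<ge> 4"
    and iso: "G \<simeq> join (copies 3 (complete_graph 1)) (complete_minus_PM p) \<or>
      G \<simeq> join (complement (path_graph 5)) (complete_minus_PM (p - 2))"
  proof -
    \<comment> \<open>The path contributes 8 and the matching on \<open>p - 2\<close> vertices
      contributes \<open>p - 2\<close>.\<close>
    have "codegree_sum (join (complement (path_graph 5)) (complete_minus_PM (p - 2))) = p + 6"
      using that(1,2) codegree_sum_join[OF simple_complement[OF simple_path_graph]
          simple_complete_minus_PM, of 5 "p - 2"]
      by (simp add: codegree_sum_complement_P5 codegree_sum_complete_minus_PM)
    then show ?thesis using iso codegree_sum_three_K1_join[OF that(1)] codegree_sum_iso by metis
  qed
  moreover have "codegree_sum G = p + 3 \<longleftrightarrow> G \<simeq> complete_minus_PM (p + 3)" if "odd p"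
  proof
    show "G \<simeq> complete_minus_PM (p + 3)" if "codegree_sum G = p + 3"
      using iso_complete_minus_PM[OF G spr] that ord by simp
    assume "G \<simeq> complete_minus_PM (p + 3)"
    then have "codegree_sum G = codegree_sum (complete_minus_PM (p + 3))" by (rule codegree_sum_iso)
    then show "codegree_sum G = p + 3" using \<open>odd p\<close> by (simp add: codegree_sum_complete_minus_PM)
  qed
  ultimately show ?thesis using odd even by auto
qed

end
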